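(* Let $(X,\mathscr{B},\mu,T,d)$ be an exponentially mixing metric measure preserving system such that $\mu$ is Ahlfors $s$-regular with $0<s<\infty$. Let $\{\ell_n\}_{n\ge 1}$ be a sequence of positive numbers tending to $0$ whose upper Besicovitch-Taylor index $\alpha$ satisfies $\alpha<s$. For $x\in X$ let $E(x)=\{y\in X: T^nx\in B(y,\ell_n)\text{ for infinitely many } n\}$. Then for any analytic set $G\subset X$, for $\mu$-almost every $x\in X$: (i) $E(x)\cap G=\varnothing$ if $\dim_{\rm P}(G)<s-\alpha$; (ii) $E(x)\cap G\neq\varnothing$ if $\dim_{\rm H}(G)>s-\alpha$. If, in addition, for a constant $b\in(0,\frac13)$ there exists an increasing sequence of positive integers $\{k_i\}$ with $k_i\to\infty$, $\lim_{i\to\infty}\frac{k_{i+1}}{k_i}=1$ and $\lim_{i\to\infty}\frac{\log_{b^{-1}} n_{k_i}}{k_i}=\alpha$, where $n_k=\#\{n\ge1:\ell_n\in[b^{k-1},b^{k-2})\}$, then for any analytic set $G\subset X$ with $\dim_{\rm P}(G)>s-\alpha$ we have $E(x)\cap G\neq\varnothing$ for $\mu$-almost every $x\in X$.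
   Context: A metric measure preserving system $(X,\mathscr{B},\mu,T,d)$ consists of a compact metric space $(X,d)$ with Borel $\sigma$-algebra $\mathscr{B}$, a measurable map $T:X\to X$ and a $T$-invariant Borel probability measure $\mu$. $B(x,r)$ denotes the closed ball with center $x$ and radius $r$. The system is exponentially mixing if there are constants $C>0$ and $0<\rho<1$ such that $|\mu(E\mid T^{-n}F)-\mu(E)|\le C\rho^n$ for all $n\ge1$, all balls $E\subseteq X$ and all $F\in\mathscr{B}$ with $\mu(F)>0$, where $\mu(A\mid B)=\mu(A\cap B)/\mu(B)$. A Borel measure $\mu$ is Ahlfors $s$-regular if there is a constant $1\le c_1<\infty$ with $c_1^{-1}r^s\le\mu(B(x,r))\le c_1r^s$ for all $x\in X$ and $0<r\le\operatorname{diam}X$. The upper Besicovitch-Taylor index of $\{\ell_n\}$ is $\alpha=\inf\{t\le s:\sum_{n=1}^\infty\ell_n^t<\infty\}=\sup\{t\le s:\sum_{n=1}^\infty\ell_n^t=\infty\}$. $\dim_{\rm H}$ and $\dim_{\rm P}$ denote Hausdorff and packing dimension in $(X,d)$; by convention both equal $-\infty$ for the empty set.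
   Formalization: The space X is assumed to have at least two points; for a one-point X, Ahlfors s-regularity is vacuous and (i) fails for G = X. *)

theory Defs
  imports "HOL-Probability.Probability"
begin

section \<open>Hausdorff and packing dimension, analytic sets\<close>

text \<open>
  A cover of \<open>A\<close> by the countably many sets \<open>U i\<close> contributes the sum of \<open>diam (U i) ^ t\<close>,
  with the conventions that the empty set contributes 0 and that \<open>0 ^ 0 = 1\<close>; HOL has
  \<open>0 powr 0 = 0\<close>, and \<^const>\<open>diameter\<close> is only meaningful on bounded sets.
\<close>

definition diam_pow :: "real \<Rightarrow> 'a::metric_space set \<Rightarrow> ennreal" where
  "diam_pow t U = (if U = {} then 0 else if t = 0 then 1 else ennreal (diameter U powr t))"

definition hausdorff_premeasure :: "real \<Rightarrow> real \<Rightarrow> 'a::metric_space set \<Rightarrow> ennreal" where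
  "hausdorff_premeasure t \<delta> A =
     Inf {(\<Sum>i. diam_pow t (U i)) | U :: nat \<Rightarrow> 'a set.
            A \<subseteq> (\<Union>i. U i) \<and> (\<forall>i. bounded (U i) \<and> diameter (U i) \<le> \<delta>)}"

definition hausdorff_measure :: "real \<Rightarrow> 'a::metric_space set \<Rightarrow> ennreal" where
  "hausdorff_measure t A = (SUP \<delta>\<in>{0<..}. hausdorff_premeasure t \<delta> A)"

definition hausdorff_dim :: "'a::metric_space set \<Rightarrow> ereal" where
  "hausdorff_dim A =
     (if A = {} then -\<infinity> else Inf {ereal t | t. 0 \<le> t \<and> hausdorff_measure t A = 0})"

text \<open>
  A \<open>\<delta>\<close>-packing of \<open>A\<close> is a countable family of pairwise disjoint closed balls with centres
  in \<open>A\<close> and radii in \<open>(0,\<delta>]\<close>. It is encoded as a set of pairs (centre, radius), because in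
  a general metric space a ball does not determine its radius. As usual in metric spaces the
  ball of radius \<open>r\<close> is weighted by \<open>(2 r) ^ t\<close>.
\<close>

definition is_packing :: "real \<Rightarrow> 'a::metric_space set \<Rightarrow> ('a \<times> real) set \<Rightarrow> bool" where
  "is_packing \<delta> A F \<longleftrightarrow>
     countable F \<and>
     (\<forall>(x, r)\<in>F. x \<in> A \<and> 0 < r \<and> r \<le> \<delta>) \<and>
     pairwise (\<lambda>(x, r) (y, q). disjnt (cball x r) (cball y q)) F"

definition packing_premeasure_delta :: "real \<Rightarrow> real \<Rightarrow> 'a::metric_space set \<Rightarrow> ennreal" where
  "packing_premeasure_delta t \<delta> A =
     Sup {(\<Sum>\<^sub>\<infinity>(x, r)\<in>F. ennreal ((2 * r) powr t)) | F. is_packing \<delta> A F}"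

definition packing_premeasure :: "real \<Rightarrow> 'a::metric_space set \<Rightarrow> ennreal" where
  "packing_premeasure t A = (INF \<delta>\<in>{0<..}. packing_premeasure_delta t \<delta> A)"

definition packing_measure :: "real \<Rightarrow> 'a::metric_space set \<Rightarrow> ennreal" where
  "packing_measure t A =
     Inf {(\<Sum>i. packing_premeasure t (V i)) | V :: nat \<Rightarrow> 'a set. A \<subseteq> (\<Union>i. V i)}"

definition packing_dim :: "'a::metric_space set \<Rightarrow> ereal" where
  "packing_dim A =
     (if A = {} then -\<infinity> else Inf {ereal t | t. 0 \<le> t \<and> packing_measure t A = 0})"

text \<open>
  The function space \<open>nat \<Rightarrow> nat\<close> carries the product topology of discrete spaces, so it is
  the Baire space.
\<close>

definition analytic_set :: "'a::topological_space set \<Rightarrow> bool" where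
  "analytic_set G \<longleftrightarrow>
     G = {} \<or> (\<exists>f :: (nat \<Rightarrow> nat) \<Rightarrow> 'a. continuous_on UNIV f \<and> G = range f)"

section \<open>Metric measure preserving systems\<close>

text \<open>The metric space \<open>X\<close> is the whole type \<open>'a\<close>.\<close>

locale metric_mps = prob_space M for M :: "'a::metric_space measure" and T :: "'a \<Rightarrow> 'a" +
  assumes compact_space: "compact (UNIV :: 'a set)"
    and sets_borel: "sets M = sets borel"
    and measurable_T: "T \<in> measurable M M"
    and invariant: "distr M M T = M"

definition exponentially_mixing :: "'a::metric_space measure \<Rightarrow> ('a \<Rightarrow> 'a) \<Rightarrow> bool" where
  "exponentially_mixing M T \<longleftrightarrow>
     (\<exists>C \<rho> :: real. 0 < C \<and> 0 < \<rho> \<and> \<rho> < 1 \<and>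
        (\<forall>n\<ge>1. \<forall>c r. \<forall>F\<in>sets M. 0 < r \<longrightarrow> 0 < measure M F \<longrightarrow>
           \<bar>cond_prob M (\<lambda>x. x \<in> cball c r) (\<lambda>x. (T ^^ n) x \<in> F) - measure M (cball c r)\<bar>
             \<le> C * \<rho> ^ n))"

text \<open>
  Pitfall: on a one-point space the diameter is 0 and the condition below is vacuous, so a point
  mass is regular for every exponent; results about positive \<open>s\<close> have to exclude that space.
\<close>

definition ahlfors_regular :: "real \<Rightarrow> 'a::metric_space measure \<Rightarrow> bool" where
  "ahlfors_regular s M \<longleftrightarrow>
     (\<exists>c\<ge>1. \<forall>x r. 0 < r \<longrightarrow> r \<le> diameter (UNIV :: 'a set) \<longrightarrow>
        inverse c * r powr s \<le> measure M (cball x r) \<and> measure M (cball x r) \<le> c * r powr s)"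

section \<open>Upper Besicovitch-Taylor index\<close>

text \<open>
  Sequences \<open>ell\<close> are indexed from 1; the value at 0 is never used. The supremum form of the index
  is used because it also gives the right value \<open>s\<close> if the series diverges for all \<open>t \<le> s\<close>,
  where the infimum form would be an infimum over the empty set. Otherwise the two agree.
\<close>

definition upper_BT_index :: "real \<Rightarrow> (nat \<Rightarrow> real) \<Rightarrow> real" where
  "upper_BT_index s ell = Sup {t. t \<le> s \<and> \<not> summable (\<lambda>n. ell (Suc n) powr t)}"

lemma upper_BT_index_eq_Inf:
  assumes s: "0 < s" and pos: "\<And>n. n \<ge> 1 \<Longrightarrow> 0 < ell n" and lim: "ell \<longlonglongrightarrow> 0"
    and ex: "t0 \<le> s" "summable (\<lambda>n. ell (Suc n) powr t0)"
  shows "upper_BT_index s ell = Inf {t. t \<le> s \<and> summable (\<lambda>n. ell (Suc n) powr t)}"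
proof -
  let ?D = "{t. t \<le> s \<and> \<not> summable (\<lambda>n. ell (Suc n) powr t)}"
  let ?C = "{t. t \<le> s \<and> summable (\<lambda>n. ell (Suc n) powr t)}"
  have lim': "(\<lambda>n. ell (Suc n)) \<longlonglongrightarrow> 0"
    using lim by (rule LIMSEQ_Suc)
  have ev: "\<forall>\<^sub>F n in sequentially. ell (Suc n) < 1"
    using order_tendstoD(2)[OF lim', of 1] by simp
  have mono: "summable (\<lambda>n. ell (Suc n) powr u)"
    if "summable (\<lambda>n. ell (Suc n) powr t)" "t \<le> u" for t u
  proof (rule summable_comparison_test_ev[OF _ that(1)])
    show "\<forall>\<^sub>F n in sequentially. norm (ell (Suc n) powr u) \<le> ell (Suc n) powr t"
      using ev
    proof eventually_elim
      case (elim n)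
      then show ?case
        using powr_mono'[OF that(2), of "ell (Suc n)"] pos[of "Suc n"] by simp
    qed
  qed
  have "ell (Suc n) powr 0 = 1" for n
    using pos[of "Suc n"] by simp
  then have zero: "0 \<in> ?D"
    using s by (simp add: summable_const_iff)
  have le: "d \<le> c" if "d \<in> ?D" "c \<in> ?C" for c d
    using mono[of c d] that by force
  have t0: "t0 \<in> ?C"
    using ex by simp
  have bdd: "bdd_above ?D" "bdd_below ?C"
    using le[OF _ t0] le[OF zero] by (meson bdd_above.I, meson bdd_below.I)
  have "Sup ?D \<le> Inf ?C"
    using zero t0 le by (intro cSup_least cInf_greatest) blast+
  moreover have "\<not> Sup ?D < Inf ?C"
  proof
    assume "Sup ?D < Inf ?C"
    then obtain m where m: "Sup ?D < m" "m < Inf ?C"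
      using dense by blast
    have "m \<le> s"
      using m(2) cInf_lower[OF t0 bdd(2)] ex(1) by linarith
    then have "m \<in> ?D \<or> m \<in> ?C"
      by blast
    then show False
      using cSup_upper[OF _ bdd(1), of m] cInf_lower[OF _ bdd(2), of m] m by linarith
  qed
  ultimately show ?thesis
    by (simp add: upper_BT_index_def)
qed

section \<open>The random covering set\<close>

definition hit_set :: "('a::metric_space \<Rightarrow> 'a) \<Rightarrow> (nat \<Rightarrow> real) \<Rightarrow> 'a \<Rightarrow> 'a set" where
  "hit_set T ell x = {y. infinite {n. n \<ge> 1 \<and> (T ^^ n) x \<in> cball y (ell n)}}"

text \<open>The exponents \<open>k - 1\<close> and \<open>k - 2\<close> are integers, and \<open>k - 2 = - 1\<close> for \<open>k = 1\<close>.\<close>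

definition level_count :: "real \<Rightarrow> (nat \<Rightarrow> real) \<Rightarrow> nat \<Rightarrow> nat" where
  "level_count b ell k = card {n. n \<ge> 1 \<and> ell n \<in> {b powi (int k - 1) ..< b powi (int k - 2)}}"

text \<open>Logarithm of a natural number with \<open>log 0 = -\<infinity>\<close>; HOL's \<^const>\<open>log\<close> gives 0 there.\<close>

definition elog :: "real \<Rightarrow> nat \<Rightarrow> ereal" where
  "elog a m = (if m = 0 then -\<infinity> else ereal (log a (real m)))"

end

theory Submission
  imports Defs "HOL-Real_Asymp.Real_Asymp"
begin

text \<open>
  The hitting statements rest on three observations.

  \<^bold>\<open>Reduction to packing numbers.\<close> The set of points hit infinitely often contains a decreasing
  intersection of open sets \<open>W N\<close>, so Baire category can produce a common point. An analytic set is
  a continuous image of the Baire space; deleting from the domain every basic open set with a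
  small image, where small means null for the \<open>t\<close>-dimensional Hausdorff or packing measure, leaves
  a closed set all of whose nonempty relatively open pieces have images that are not small
  (\<open>sigma_ideal_kernel\<close>). By Baire's theorem it is enough that each of countably many such images
  \<open>A\<close> meets each \<open>W N\<close> (\<open>analytic_set_test_family\<close>, \<open>AE_hit_set_meets\<close>). This replaces Frostman
  measures and energy estimates: only the number of disjoint balls centred in \<open>A\<close> matters, and
  only at one scale at a time.

  \<^bold>\<open>Hitting at a single scale.\<close> Suppose \<open>A\<close> contains \<open>r powr - t\<close> centres of disjoint balls
  of radius \<open>r\<close>. Their union \<open>U\<close> has measure comparable to \<open>r powr (s - t)\<close>. If \<open>r powr - a\<close> of the
  numbers \<open>ell n\<close> exceed \<open>r\<close> and \<open>s < t + a\<close>, the expected number of visits of the orbit to \<open>U\<close> at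
  these times grows like a negative power of \<open>r\<close>. Mixing decouples two visits once the times are
  further apart than a multiple of \<open>log (1 / r)\<close>, so the second moment method shows that the orbit misses \<open>U\<close> with
  probability tending to \<open>0\<close> along the scales in question (\<open>prob_miss_packing_le\<close>,
  \<open>AE_hits_neighbourhood\<close>).

  \<^bold>\<open>Matching scales.\<close> Positive Hausdorff measure gives many disjoint balls at all small scales, and
  the index \<open>\<alpha>\<close> gives many large \<open>ell n\<close> at some arbitrarily small scales, so both happen together.
  Positive packing measure gives many disjoint balls only at some arbitrarily small scales; the
  regular growth of the level counts along \<open>k i\<close> with \<open>k (Suc i) / k i\<close> tending to \<open>1\<close> allows moving
  such a scale to the next \<open>b ^ k j\<close> at an arbitrarily small cost in the exponent
  (\<open>frequently_large_packing_along_scales\<close>).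

  The statement on \<open>dim\<^sub>P G < s - \<alpha>\<close> is a first moment bound: \<open>G\<close> is covered by countably many sets
  with packing numbers at most a constant times \<open>r powr - t\<close>, where \<open>t < s - \<alpha>\<close>, and the Borel-Cantelli
  lemma applies because \<open>ell n powr (s - t)\<close> is summable.
\<close>

section \<open>Small sets and analytic sets\<close>

definition sigma_ideal :: "('a set \<Rightarrow> bool) \<Rightarrow> bool" where
  "sigma_ideal small \<longleftrightarrow> small {} \<and> (\<forall>A B. small A \<longrightarrow> B \<subseteq> A \<longrightarrow> small B) \<and>
     (\<forall>A :: nat \<Rightarrow> 'a set. (\<forall>n. small (A n)) \<longrightarrow> small (\<Union>n. A n))"

lemma sigma_ideal_countable_Union:
  assumes "sigma_ideal small" "countable \<A>" "\<And>A. A \<in> \<A> \<Longrightarrow> small A"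
  shows "small (\<Union>\<A>)"
proof (cases "\<A> = {}")
  case False
  then have "\<Union>\<A> = (\<Union>n. from_nat_into \<A> n)"
    using assms(2) by (simp add: range_from_nat_into)
  moreover have "small (from_nat_into \<A> n)" for n
    using assms(3) from_nat_into[OF False] by blast
  ultimately show ?thesis
    using assms(1) unfolding sigma_ideal_def by metis
qed (use assms(1) in \<open>simp add: sigma_ideal_def\<close>)

lemma sigma_ideal_subset:
  assumes "sigma_ideal small" "small A" "B \<subseteq> A"
  shows "small B"
  using assms unfolding sigma_ideal_def by blast

lemma sigma_ideal_Un:
  assumes "sigma_ideal small" "small A" "small B"
  shows "small (A \<union> B)"
  using sigma_ideal_countable_Union[of small "{A, B}"] assms by auto

text \<open>
  As in the Cantor-Bendixson theorem: the union of the basic open sets with small image is a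
  countable union, so its image is small and can be discarded. What remains has no small open piece,
  since such a piece together with the discarded part would again have a small image.
\<close>
lemma sigma_ideal_kernel:
  fixes f :: "'b::second_countable_topology \<Rightarrow> 'a"
  assumes I: "sigma_ideal small" and G: "\<not> small (range f)"
  obtains F where "closed F" "F \<noteq> {}"
    "\<And>V. open V \<Longrightarrow> V \<inter> F \<noteq> {} \<Longrightarrow> \<not> small (f ` (V \<inter> F))"
proof -
  obtain \<B> :: "'b set set" where \<B>: "countable \<B>" "topological_basis \<B>"
    using ex_countable_basis by blast
  define W where "W = \<Union>{V \<in> \<B>. small (f ` V)}"
  have W: "small (f ` W)"
  proof -
    have "small (\<Union>((`) f ` {V \<in> \<B>. small (f ` V)}))"
      using \<B>(1) by (intro sigma_ideal_countable_Union[OF I]) auto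
    then show ?thesis
      by (simp add: W_def image_Union)
  qed
  have "open W"
    unfolding W_def using topological_basis_open[OF \<B>(2)] by blast
  moreover have "- W \<noteq> {}"
    using W G by (metis Compl_empty_eq double_complement)
  moreover have "\<not> small (f ` (V \<inter> - W))" if V: "open V" "V \<inter> - W \<noteq> {}" for V
  proof
    assume sm: "small (f ` (V \<inter> - W))"
    obtain x where x: "x \<in> V" "x \<notin> W"
      using V(2) by blast
    obtain U where U: "U \<in> \<B>" "x \<in> U" "U \<subseteq> V"
      using topological_basisE[OF \<B>(2) V(1) x(1)] by blast
    have "small (f ` (V \<inter> - W) \<union> f ` W)"
      using sm W by (rule sigma_ideal_Un[OF I])
    then have "small (f ` U)"
      by (rule sigma_ideal_subset[OF I]) (use U(3) in blast)
    then have "x \<in> W"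
      using U unfolding W_def by blast
    then show False
      using x(2) by blast
  qed
  ultimately show ?thesis
    using that[of "- W"] by (simp add: closed_Compl)
qed

lemma completely_metrizable_Baire_space:
  "completely_metrizable_space (euclidean :: (nat \<Rightarrow> nat) topology)"
proof -
  have "(euclidean :: nat topology) = discrete_topology UNIV"
    unfolding topology_eq by (simp add: Topological_Spaces.open_discrete)
  then show ?thesis
    by (simp add: euclidean_product_topology[symmetric] completely_metrizable_space_product_topology
        completely_metrizable_space_discrete_topology)
qed

text \<open>
  The family consists of the images of the basic open pieces of the kernel. If all of them meet
  every \<open>W n\<close>, the preimages of the \<open>W n\<close> are dense open subsets of a closed subspace of the Baire
  space, and Baire's theorem applies there even though \<open>G\<close> itself need not be complete.
\<close>
lemma analytic_set_test_family:
  fixes G :: "'a::topological_space set"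
  assumes I: "sigma_ideal small" and an: "analytic_set G" and G: "\<not> small G"
  shows "\<exists>\<A> :: 'a set set. countable \<A> \<and> (\<forall>A\<in>\<A>. \<not> small A) \<and>
    (\<forall>W :: nat \<Rightarrow> 'a set. (\<forall>n. open (W n)) \<longrightarrow> (\<forall>A\<in>\<A>. \<forall>n. A \<inter> W n \<noteq> {}) \<longrightarrow>
       G \<inter> (\<Inter>n. W n) \<noteq> {})"
proof -
  have "G \<noteq> {}"
    using I G unfolding sigma_ideal_def by blast
  then obtain f :: "(nat \<Rightarrow> nat) \<Rightarrow> 'a" where f: "continuous_on UNIV f" "G = range f"
    using an unfolding analytic_set_def by blast
  obtain F where F: "closed F" "F \<noteq> {}"
    "\<And>V. open V \<Longrightarrow> V \<inter> F \<noteq> {} \<Longrightarrow> \<not> small (f ` (V \<inter> F))"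
    using sigma_ideal_kernel[OF I, of f] G f(2) by blast
  obtain \<B> :: "(nat \<Rightarrow> nat) set set" where \<B>: "countable \<B>" "topological_basis \<B>"
    using ex_countable_basis by blast
  define \<A> where "\<A> = (\<lambda>V. f ` (V \<inter> F)) ` {V \<in> \<B>. V \<inter> F \<noteq> {}}"
  have Baire: "completely_metrizable_space (top_of_set F)"
    by (intro completely_metrizable_space_closedin completely_metrizable_Baire_space)
       (use F(1) in simp)
  show ?thesis
  proof (intro exI[of _ \<A>] conjI ballI allI impI)
    show "countable \<A>"
      using \<B>(1) by (simp add: \<A>_def)
    show "\<not> small A" if "A \<in> \<A>" for A
      using that F(3) topological_basis_open[OF \<B>(2)] unfolding \<A>_def by blast
    show "G \<inter> (\<Inter>n. W n) \<noteq> {}"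
      if W: "\<forall>n. open (W n)" "\<forall>A\<in>\<A>. \<forall>n. A \<inter> W n \<noteq> {}" for W :: "nat \<Rightarrow> 'a set"
    proof -
      define D where "D n = F \<inter> f -` W n" for n
      have op: "openin (top_of_set F) (D n)" for n
        unfolding D_def using continuous_on_subset[OF f(1) subset_UNIV] W(1)[rule_format]
        by (rule continuous_openin_preimage_gen)
      have dense: "top_of_set F closure_of D n = F" for n
      proof -
        have "D n \<inter> V \<noteq> {}" if V: "openin (top_of_set F) V" "V \<noteq> {}" for V
        proof -
          obtain U where U: "open U" "V = F \<inter> U"
            using V(1) by (meson openin_open)
          obtain x where x: "x \<in> F" "x \<in> U"
            using V(2) U(2) by blast
          obtain B where B: "B \<in> \<B>" "x \<in> B" "B \<subseteq> U"
            using topological_basisE[OF \<B>(2) U(1) x(2)] by blast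
          have "f ` (B \<inter> F) \<inter> W n \<noteq> {}"
            using W(2)[rule_format, of "f ` (B \<inter> F)"] B x unfolding \<A>_def by blast
          then show ?thesis
            using B(3) U(2) unfolding D_def by blast
        qed
        then show ?thesis
          using dense_intersects_open[of "top_of_set F" "D n"] by simp
      qed
      have "top_of_set F closure_of \<Inter>(range D) = topspace (top_of_set F)"
        by (rule Baire_category) (use Baire op dense in auto)
      then have "\<Inter>(range D) \<noteq> {}"
        using F(2) by auto
      then show ?thesis
        unfolding D_def f(2) by blast
    qed
  qed
qed

section \<open>Null sets of Hausdorff and packing measures\<close>

lemma sigma_ideal_Ball:
  assumes "\<And>d. d \<in> D \<Longrightarrow> sigma_ideal (small d)"
  shows "sigma_ideal (\<lambda>A. \<forall>d\<in>D. small d A)"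
  using assms unfolding sigma_ideal_def by meson

text \<open>
  Both the Hausdorff premeasures and the packing measure are infima of sums over countable covers,
  so one argument with \<open>e / 2 ^ Suc n\<close> covers both.
\<close>
lemma sigma_ideal_cover_null:
  fixes \<phi> :: "'a set \<Rightarrow> ennreal"
  assumes "P {}" "\<phi> {} = 0"
  shows "sigma_ideal (\<lambda>A. Inf {\<Sum>i. \<phi> (U i) | U :: nat \<Rightarrow> 'a set. A \<subseteq> (\<Union>i. U i) \<and> (\<forall>i. P (U i))} = 0)"
    (is "sigma_ideal (\<lambda>A. ?\<mu> A = 0)")
proof -
  have le: "?\<mu> A \<le> (\<Sum>i. \<phi> (U i))" if "A \<subseteq> (\<Union>i. U i)" "\<And>i. P (U i)" for A U
    using that by (intro Inf_lower) blast
  have mono: "?\<mu> B \<le> ?\<mu> A" if "B \<subseteq> A" for A B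
    using that by (intro Inf_superset_mono) blast
  have "?\<mu> {} \<le> (\<Sum>i. \<phi> {})"
    using assms(1) by (intro le[of _ "\<lambda>_. {}"]) auto
  then have empty: "?\<mu> {} = 0"
    using assms(2) by simp
  have "?\<mu> (\<Union>n. A n) = 0" if A: "\<And>n. ?\<mu> (A n) = 0" for A :: "nat \<Rightarrow> 'a set"
  proof -
    have "?\<mu> (\<Union>n. A n) \<le> 0 + ennreal e" if e: "0 < e" for e :: real
    proof -
      have "\<exists>U. A n \<subseteq> (\<Union>i. U i) \<and> (\<forall>i. P (U i)) \<and> (\<Sum>i. \<phi> (U i)) < ennreal e * (1/2) ^ Suc n" for n
      proof -
        have "0 < ennreal (e * (1/2) ^ Suc n)"
          using e by simp
        also have "ennreal (e * (1/2) ^ Suc n) = ennreal e * (1/2) ^ Suc n"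
          using e by (simp add: ennreal_mult ennreal_power[symmetric] divide_ennreal[symmetric]
              divide_ennreal_def del: power_Suc)
        finally have "?\<mu> (A n) < ennreal e * (1/2) ^ Suc n"
          by (simp only: A)
        then show ?thesis
          unfolding Inf_less_iff by blast
      qed
      then obtain U where U: "\<And>n. A n \<subseteq> (\<Union>i. U n i)" "\<And>n i. P (U n i)"
        "\<And>n. (\<Sum>i. \<phi> (U n i)) < ennreal e * (1/2) ^ Suc n"
        by metis
      define W where "W i = case_prod U (prod_decode i)" for i
      have sub: "(\<Union>n. A n) \<subseteq> (\<Union>i. W i)"
      proof
        fix x assume "x \<in> (\<Union>n. A n)"
        then obtain n i where "x \<in> U n i"
          using U(1) by blast
        then have "x \<in> W (prod_encode (n, i))"
          by (simp add: W_def)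
        then show "x \<in> (\<Union>i. W i)"
          by blast
      qed
      have "?\<mu> (\<Union>n. A n) \<le> (\<Sum>i. \<phi> (W i))"
        by (rule le[OF sub]) (simp add: W_def U(2) split: prod.split)
      also have "\<dots> = (\<Sum>n. \<Sum>i. \<phi> (U n i))"
        unfolding W_def by (rule suminf_ennreal_2dimen[where f = "\<lambda>p. \<phi> (case_prod U p)"]) simp
      also have "\<dots> \<le> (\<Sum>n. ennreal e * (1/2) ^ Suc n)"
        by (intro suminf_le less_imp_le[OF U(3)] summableI)
      also have "\<dots> = ennreal e"
      proof -
        have "(\<Sum>n. ennreal ((1/2) ^ Suc n)) = ennreal 1"
          by (rule suminf_ennreal_eq[OF _ power_half_series]) simp
        moreover have "ennreal ((1/2) ^ Suc n) = (1/2) ^ Suc n" for n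
          by (simp add: ennreal_power[symmetric] divide_ennreal[symmetric] divide_ennreal_def
              del: power_Suc)
        ultimately show ?thesis
          unfolding ennreal_suminf_cmult by simp
      qed
      finally show ?thesis
        by simp
    qed
    then have "?\<mu> (\<Union>n. A n) \<le> 0"
      by (rule ennreal_le_epsilon)
    then show ?thesis
      by simp
  qed
  moreover have "?\<mu> B = 0" if "?\<mu> A = 0" "B \<subseteq> A" for A B
    using mono[OF that(2)] that(1) by simp
  ultimately show ?thesis
    using empty unfolding sigma_ideal_def by blast
qed

lemma hausdorff_measure_eq_0_iff:
  "hausdorff_measure t A = 0 \<longleftrightarrow> (\<forall>\<delta>\<in>{0<..}. hausdorff_premeasure t \<delta> A = 0)"
  unfolding hausdorff_measure_def
  by (metis (no_types, lifting) SUP_bot_conv(1) bot_ennreal)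

lemma sigma_ideal_hausdorff_null:
  "sigma_ideal (\<lambda>A :: 'a::metric_space set. hausdorff_measure t A = 0)"
  unfolding hausdorff_measure_eq_0_iff hausdorff_premeasure_def
  by (intro sigma_ideal_Ball sigma_ideal_cover_null) (auto simp: diam_pow_def)

lemma packing_premeasure_empty: "packing_premeasure t ({} :: 'a::metric_space set) = 0"
proof -
  have "packing_premeasure_delta t \<delta> ({} :: 'a set) = 0" for \<delta>
  proof -
    have "F = {}" if "is_packing \<delta> ({} :: 'a set) F" for F
      using that unfolding is_packing_def by fast
    then have "(\<Sum>\<^sub>\<infinity>(x, r)\<in>F. ennreal ((2 * r) powr t)) = 0" if "is_packing \<delta> ({} :: 'a set) F" for F
      using that by fastforce
    then have "packing_premeasure_delta t \<delta> ({} :: 'a set) \<le> 0"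
      unfolding packing_premeasure_delta_def by (intro Sup_least) auto
    then show ?thesis
      by simp
  qed
  then show ?thesis
    unfolding packing_premeasure_def by simp
qed

lemma sigma_ideal_packing_null:
  "sigma_ideal (\<lambda>A :: 'a::metric_space set. packing_measure t A = 0)"
  using sigma_ideal_cover_null[where \<phi> = "packing_premeasure t" and P = "\<lambda>_. True"]
  unfolding packing_measure_def by (simp add: packing_premeasure_empty)

section \<open>Packings by balls of equal radius\<close>

text \<open>
  All balls have the same radius, so that only the centres need to be recorded, and the largest size
  of such a packing plays the role of a covering number at scale \<open>r\<close>.
\<close>
definition ball_packing :: "real \<Rightarrow> 'a::metric_space set \<Rightarrow> 'a set \<Rightarrow> bool" where
  "ball_packing r A Y \<longleftrightarrow>
     finite Y \<and> Y \<subseteq> A \<and> pairwise (\<lambda>x y. disjnt (cball x r) (cball y r)) Y"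

lemma ball_packing_mono:
  assumes "ball_packing r A Y" "r' \<le> r"
  shows "ball_packing r' A Y"
proof -
  have "disjnt (cball x r') (cball y r')" if "disjnt (cball x r) (cball y r)" for x y :: 'a
    using that assms(2) by (meson disjnt_subset1 disjnt_subset2 subset_cball)
  then show ?thesis
    using assms(1) unfolding ball_packing_def pairwise_def by blast
qed

lemma ball_packing_card_bound:
  assumes "compact (UNIV :: 'a::metric_space set)" "0 < r"
  shows "\<exists>b. \<forall>A (Y :: 'a::metric_space set). ball_packing r A Y \<longrightarrow> card Y \<le> b"
proof -
  obtain k :: "'a set" where k: "finite k" "UNIV \<subseteq> (\<Union>x\<in>k. ball x r)"
    using assms unfolding compact_eq_totally_bounded by meson
  have "card Y \<le> card k" if "ball_packing r A Y" for A Y :: "'a set"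
  proof -
    have "\<forall>y. \<exists>x\<in>k. y \<in> ball x r"
      using k(2) by blast
    then obtain g where g: "\<And>y. g y \<in> k" "\<And>y. y \<in> ball (g y) r"
      by metis
    have "inj_on g Y"
    proof (rule inj_onI, rule ccontr)
      fix x y assume *: "x \<in> Y" "y \<in> Y" "g x = g y" "x \<noteq> y"
      then have "disjnt (cball x r) (cball y r)"
        using that unfolding ball_packing_def pairwise_def by blast
      moreover have "g x \<in> cball x r" "g x \<in> cball y r"
        using g(2)[of x] g(2)[of y] *(3) by (auto simp: dist_commute)
      ultimately show False
        unfolding disjnt_def by blast
    qed
    then show ?thesis
      by (rule card_inj_on_le) (use g(1) k(1) in auto)
  qed
  then show ?thesis
    by blast
qed

text \<open>
  A packing of the largest possible size exists by total boundedness, and a point further than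
  \<open>2 * r\<close> from all centres could be added to it.
\<close>
lemma ball_packing_maximal:
  fixes A :: "'a::metric_space set"
  assumes "compact (UNIV :: 'a set)" "0 < r"
  obtains Y where "ball_packing r A Y" "A \<subseteq> (\<Union>y\<in>Y. cball y (2 * r))"
proof -
  obtain b where b: "\<And>A (Y :: 'a set). ball_packing r A Y \<Longrightarrow> card Y \<le> b"
    using ball_packing_card_bound[OF assms] by blast
  have "\<exists>Y. ball_packing r A Y \<and> (\<forall>Z. ball_packing r A Z \<longrightarrow> card Z \<le> card Y)"
    by (rule Lattices_Big.ex_has_greatest_nat[of _ "{}" card "Suc b"])
       (use b[of A] in \<open>auto simp: ball_packing_def less_Suc_eq_le\<close>)
  then obtain Y where Y: "ball_packing r A Y" "\<And>Z. ball_packing r A Z \<Longrightarrow> card Z \<le> card Y"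
    by blast
  have "v \<in> (\<Union>y\<in>Y. cball y (2 * r))" if v: "v \<in> A" for v
  proof (rule ccontr)
    assume far: "v \<notin> (\<Union>y\<in>Y. cball y (2 * r))"
    then have "v \<notin> Y"
      using assms(2) by auto
    have "disjnt (cball v r) (cball y r)" if "y \<in> Y" for y
    proof (rule ccontr)
      assume "\<not> disjnt (cball v r) (cball y r)"
      then obtain z where "dist v z \<le> r" "dist y z \<le> r"
        unfolding disjnt_def by auto
      then have "dist y v \<le> 2 * r"
        using dist_triangle[of y v z] by (simp add: dist_commute)
      then show False
        using far that by auto
    qed
    then have "ball_packing r A (insert v Y)"
      using Y(1) v unfolding ball_packing_def by (auto simp: pairwise_insert disjnt_sym)
    then have "card (insert v Y) \<le> card Y"
      by (rule Y(2))
    then show False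
      using \<open>v \<notin> Y\<close> Y(1) by (simp add: ball_packing_def)
  qed
  then show ?thesis
    using that Y(1) by blast
qed

lemma hausdorff_premeasure_le_card:
  fixes A :: "'a::metric_space set"
  assumes "finite Y" "A \<subseteq> (\<Union>y\<in>Y. cball y (2 * r))" "0 < r" "0 < t" "4 * r \<le> \<delta>"
  shows "hausdorff_premeasure t \<delta> A \<le> ennreal (real (card Y) * (4 * r) powr t)"
proof -
  obtain h where h: "bij_betw h {0..<card Y} Y"
    using ex_bij_betw_nat_finite[OF assms(1)] by blast
  define U where "U i = (if i < card Y then cball (h i) (2 * r) else {})" for i
  have diam: "diameter (U i) \<le> 4 * r" for i
  proof (cases "U i = {}")
    case False
    have "dist x y \<le> 4 * r" if "x \<in> cball z (2 * r)" "y \<in> cball z (2 * r)" for x y z :: 'a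
      using that dist_triangle3[of x y z] by simp
    then show ?thesis
      using False unfolding diameter_def U_def
      by (auto intro!: cSUP_least split: if_splits)
  qed (use assms(3) in simp)
  have "(\<Sum>i. diam_pow t (U i)) = (\<Sum>i<card Y. diam_pow t (U i))"
    by (rule suminf_finite) (auto simp: U_def diam_pow_def)
  also have "\<dots> \<le> (\<Sum>i<card Y. ennreal ((4 * r) powr t))"
  proof (rule sum_mono)
    fix i
    have "0 \<le> diameter (U i)"
      by (rule diameter_ge_0) (simp add: U_def)
    then show "diam_pow t (U i) \<le> ennreal ((4 * r) powr t)"
      using diam[of i] assms(4) by (auto simp: diam_pow_def intro!: ennreal_leI powr_mono2)
  qed
  also have "\<dots> = ennreal (real (card Y) * (4 * r) powr t)"
    by (simp add: ennreal_mult ennreal_of_nat_eq_real_of_nat)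
  finally have sum: "(\<Sum>i. diam_pow t (U i)) \<le> ennreal (real (card Y) * (4 * r) powr t)" .
  have "hausdorff_premeasure t \<delta> A \<le> (\<Sum>i. diam_pow t (U i))"
    unfolding hausdorff_premeasure_def
  proof (intro Inf_lower CollectI exI[of _ U] conjI allI refl)
    show "A \<subseteq> (\<Union>i. U i)"
    proof
      fix x assume "x \<in> A"
      then obtain y where y: "y \<in> Y" "x \<in> cball y (2 * r)"
        using assms(2) by blast
      then obtain i where "i < card Y" "h i = y"
        using h unfolding bij_betw_def by force
      then show "x \<in> (\<Union>i. U i)"
        using y(2) unfolding U_def by (auto intro!: exI[of _ i])
    qed
    show "bounded (U i)" "diameter (U i) \<le> \<delta>" for i
      using diam[of i] assms(5) by (auto simp: U_def)
  qed
  then show ?thesis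
    using sum by (rule order_trans)
qed

text \<open>
  A maximal packing gives a cover by sets of diameter at most \<open>4 * r\<close>, so a positive premeasure bounds
  its size from below. In terms of dimensions, Hausdorff dimension is at most lower box dimension.
\<close>
lemma eventually_large_packing_of_hausdorff:
  fixes A :: "'a::metric_space set"
  assumes "compact (UNIV :: 'a set)" "0 < t" "hausdorff_measure t A \<noteq> 0"
  shows "\<exists>h>0. \<forall>\<^sub>F r in at_right 0. \<exists>Y. ball_packing r A Y \<and> h * r powr - t \<le> real (card Y)"
proof -
  obtain \<delta> where \<delta>: "0 < \<delta>" "hausdorff_premeasure t \<delta> A \<noteq> 0"
    using assms(3) unfolding hausdorff_measure_eq_0_iff by auto
  obtain e where e: "0 < e" "ennreal e \<le> hausdorff_premeasure t \<delta> A"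
  proof (cases "hausdorff_premeasure t \<delta> A")
    case (real x)
    then show ?thesis
      using that[of x] \<delta>(2) by (cases "x = 0") auto
  qed (use that[of 1] in simp)
  have "\<exists>Y. ball_packing r A Y \<and> (e * 4 powr - t) * r powr - t \<le> real (card Y)"
    if r: "0 < r" "r < \<delta> / 4" for r
  proof -
    obtain Y where Y: "ball_packing r A Y" "A \<subseteq> (\<Union>y\<in>Y. cball y (2 * r))"
      using ball_packing_maximal[OF assms(1) r(1)] by blast
    have "hausdorff_premeasure t \<delta> A \<le> ennreal (real (card Y) * (4 * r) powr t)"
      using Y r assms(2) by (intro hausdorff_premeasure_le_card) (auto simp: ball_packing_def)
    with e(2) have "ennreal e \<le> ennreal (real (card Y) * (4 * r) powr t)"
      by (rule order_trans)
    then have "e \<le> real (card Y) * (4 * r) powr t"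
      by (simp add: ennreal_le_iff)
    then have "e * (4 * r) powr - t \<le> real (card Y)"
      using r by (simp add: powr_minus divide_simps)
    then show ?thesis
      using Y(1) r(1) by (auto simp: powr_mult mult.assoc)
  qed
  then have "\<forall>\<^sub>F r in at_right 0. \<exists>Y. ball_packing r A Y \<and> (e * 4 powr - t) * r powr - t \<le> real (card Y)"
    unfolding eventually_at_right_field using \<delta>(1) by (intro exI[of _ "\<delta> / 4"]) auto
  moreover have "0 < e * 4 powr - t"
    using e(1) by simp
  ultimately show ?thesis
    by blast
qed

section \<open>Dyadic counting\<close>

text \<open>
  Rounding each \<open>r i\<close> to a power of \<open>1/2\<close> and exchanging the order of summation turns the sum into
  a geometric series with ratio \<open>(1/2) powr (t - u)\<close>. The estimate serves twice: with \<open>r i\<close> from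
  the sequence \<open>ell\<close>, and with \<open>r i\<close> the radii of a packing.
\<close>
lemma sum_powr_le_of_counts:
  fixes r :: "'i \<Rightarrow> real"
  assumes fin: "finite S" and t: "0 \<le> t" "u < t"
    and r: "\<And>i. i \<in> S \<Longrightarrow> 0 < r i" "\<And>i. i \<in> S \<Longrightarrow> r i \<le> (1/2) ^ m"
    and count: "\<And>k. m \<le> k \<Longrightarrow> real (card {i\<in>S. (1/2) ^ k < r i}) \<le> ((1/2) ^ k) powr - u"
  shows "(\<Sum>i\<in>S. r i powr t) \<le> 2 powr t * ((1/2) powr (t - u)) ^ m / (1 - (1/2) powr (t - u))"
proof -
  define q :: real where "q = (1/2) powr (t - u)"
  have "(1/2) powr (t - u) < (1/2 :: real) powr 0"
    using t(2) by (intro powr_less_mono') auto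
  then have q: "0 < q" "q < 1"
    by (auto simp: q_def)
  define g where "g k i = (if (1/2) ^ k < r i then 2 powr t * ((1/2) ^ k) powr t else 0)" for k i
  have g_nonneg: "0 \<le> g k i" for k i
    by (simp add: g_def)
  have "\<exists>k\<ge>m. r i powr t \<le> g k i" if i: "i \<in> S" for i
  proof -
    \<comment> \<open>Minimality of \<open>k\<close> puts \<open>r i\<close> between \<open>(1/2) ^ k\<close> and twice that value.\<close>
    define k where "k = (LEAST k. (1/2) ^ k < r i)"
    have "\<exists>k. (1/2) ^ k < r i"
      using r(1)[OF i] by (intro real_arch_pow_inv) auto
    then have k: "(1/2) ^ k < r i"
      unfolding k_def by (rule LeastI_ex)
    have "m < k"
    proof (rule ccontr)
      assume "\<not> m < k"
      then have "(1/2) ^ m \<le> (1/2 :: real) ^ k"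
        by (intro power_decreasing) auto
      then show False
        using k r(2)[OF i] by linarith
    qed
    then obtain j where j: "k = Suc j"
      by (cases k) auto
    have "\<not> (1/2) ^ j < r i"
      using not_less_Least[of j "\<lambda>k. (1/2) ^ k < r i"] j k_def by simp
    then have "r i \<le> 2 * (1/2) ^ k"
      by (simp add: j)
    then have "r i powr t \<le> (2 * (1/2) ^ k) powr t"
      using r(1)[OF i] t(1) by (intro powr_mono2) auto
    also have "\<dots> = g k i"
      using k by (simp add: g_def powr_mult)
    finally show ?thesis
      using \<open>m < k\<close> less_imp_le by blast
  qed
  then obtain \<kappa> where \<kappa>: "\<And>i. i \<in> S \<Longrightarrow> m \<le> \<kappa> i" "\<And>i. i \<in> S \<Longrightarrow> r i powr t \<le> g (\<kappa> i) i"
    by metis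
  obtain K where K: "\<And>i. i \<in> S \<Longrightarrow> \<kappa> i \<le> K"
    using finite_nat_set_iff_bounded_le[of "\<kappa> ` S"] fin by auto
  have "(\<Sum>i\<in>S. r i powr t) \<le> (\<Sum>i\<in>S. \<Sum>k=m..K. g k i)"
  proof (rule sum_mono)
    fix i assume i: "i \<in> S"
    have "g (\<kappa> i) i \<le> (\<Sum>k=m..K. g k i)"
      using \<kappa>(1)[OF i] K[OF i] g_nonneg by (intro member_le_sum) auto
    then show "r i powr t \<le> (\<Sum>k=m..K. g k i)"
      using \<kappa>(2)[OF i] by linarith
  qed
  also have "\<dots> = (\<Sum>k=m..K. \<Sum>i\<in>S. g k i)"
    by (rule sum.swap)
  also have "\<dots> \<le> (\<Sum>k=m..K. 2 powr t * q ^ k)"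
  proof (rule sum_mono)
    fix k assume k: "k \<in> {m..K}"
    have "(\<Sum>i\<in>S. g k i) = real (card {i\<in>S. (1/2) ^ k < r i}) * (2 powr t * ((1/2) ^ k) powr t)"
      using fin by (simp add: g_def sum.If_cases Int_def)
    also have "\<dots> \<le> ((1/2) ^ k) powr - u * (2 powr t * ((1/2) ^ k) powr t)"
      using count[of k] k by (intro mult_right_mono) auto
    also have "\<dots> = 2 powr t * ((1/2) ^ k) powr (t - u)"
      by (simp add: powr_add[symmetric] algebra_simps)
    also have "((1/2) ^ k) powr (t - u) = q ^ k"
      by (simp add: q_def powr_power powr_realpow[symmetric] powr_powr mult.commute)
    finally show "(\<Sum>i\<in>S. g k i) \<le> 2 powr t * q ^ k" .
  qed
  also have "\<dots> = 2 powr t * (\<Sum>k=m..K. q ^ k)"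
    by (rule sum_distrib_left[symmetric])
  also have "\<dots> \<le> 2 powr t * (q ^ m / (1 - q))"
    using q by (intro mult_left_mono) (auto simp: sum_gp divide_simps)
  finally show ?thesis
    by (simp add: q_def)
qed

lemma finite_large_terms:
  fixes ell :: "nat \<Rightarrow> real"
  assumes "ell \<longlonglongrightarrow> 0" "0 < r"
  shows "finite {n. 1 \<le> n \<and> r < ell n}"
proof -
  obtain N where "\<And>n. N \<le> n \<Longrightarrow> ell n < r"
    using order_tendstoD(2)[OF assms] by (auto simp: eventually_sequentially)
  then have "{n. 1 \<le> n \<and> r < ell n} \<subseteq> {..<N}"
    by (force simp: not_le[symmetric])
  then show ?thesis
    using finite_subset by blast
qed

text \<open>
  If the counts were below \<open>r powr - a\<close> at all small scales, the series would converge for every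
  exponent above \<open>a\<close>, contradicting \<open>a < upper_BT_index s ell\<close>.
\<close>
lemma frequently_many_large_terms:
  assumes pos: "\<And>n. n \<ge> 1 \<Longrightarrow> 0 < ell n" and lim: "ell \<longlonglongrightarrow> 0"
    and a: "0 \<le> a" "a < upper_BT_index s ell" and s: "0 < s"
  shows "\<exists>\<^sub>F r in at_right 0. r powr - a \<le> real (card {n. 1 \<le> n \<and> r < ell n})"
proof (rule ccontr)
  let ?D = "{t. t \<le> s \<and> \<not> summable (\<lambda>n. ell (Suc n) powr t)}"
  assume "\<not> ?thesis"
  then obtain r0 where r0: "0 < r0"
    "\<And>r. 0 < r \<Longrightarrow> r < r0 \<Longrightarrow> real (card {n. 1 \<le> n \<and> r < ell n}) < r powr - a"
    by (auto simp: frequently_def eventually_at_right_field not_le)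
  have "ell (Suc n) powr 0 = 1" for n
    using pos[of "Suc n"] by simp
  then have "0 \<in> ?D"
    using s by (simp add: summable_const_iff)
  then have "?D \<noteq> {}"
    by blast
  moreover have "bdd_above ?D"
    by (intro bdd_aboveI[of _ s]) auto
  ultimately obtain t where t: "\<not> summable (\<lambda>n. ell (Suc n) powr t)" "a < t"
    using a(2) unfolding upper_BT_index_def by (subst (asm) less_cSup_iff) auto
  obtain m where m: "(1/2) ^ m < r0"
    using real_arch_pow_inv[OF r0(1), of "1/2"] by auto
  have "\<forall>\<^sub>F n in sequentially. ell n < (1/2) ^ m"
    using order_tendstoD(2)[OF lim] by simp
  then obtain n0 where n0: "\<And>n. n0 \<le> n \<Longrightarrow> ell n < (1/2) ^ m"
    by (auto simp: eventually_sequentially)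
  have "summable (\<lambda>n. ell (Suc (n + n0)) powr t)"
  proof (rule summableI_nonneg_bounded)
    show "(\<Sum>i<N. ell (Suc (i + n0)) powr t)
        \<le> 2 powr t * ((1/2) powr (t - a)) ^ m / (1 - (1/2) powr (t - a))" for N
    proof (rule sum_powr_le_of_counts)
      fix k assume "m \<le> k"
      then have "(1/2) ^ k \<le> (1/2 :: real) ^ m"
        by (intro power_decreasing) auto
      then have k: "(1/2) ^ k < r0"
        using m by linarith
      have "card {i \<in> {..<N}. (1/2) ^ k < ell (Suc (i + n0))} \<le> card {n. 1 \<le> n \<and> (1/2) ^ k < ell n}"
        using finite_large_terms[OF lim, of "(1/2) ^ k"]
        by (intro card_inj_on_le[of "\<lambda>i. Suc (i + n0)"]) (auto intro!: inj_onI)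
      then show "real (card {i \<in> {..<N}. (1/2) ^ k < ell (Suc (i + n0))}) \<le> ((1/2) ^ k) powr - a"
        using r0(2)[of "(1/2) ^ k"] k by simp
    qed (use t(2) a(1) pos in \<open>auto intro!: less_imp_le[OF n0]\<close>)
  qed simp
  then have "summable (\<lambda>n. ell (Suc n) powr t)"
    by (subst (asm) summable_iff_shift[where f = "\<lambda>n. ell (Suc n) powr t"])
  then show False
    using t(1) by blast
qed

text \<open>
  If the packing numbers at all small scales were below \<open>r powr - u\<close> with \<open>u < t\<close>, the balls of an
  arbitrary packing could be sorted by their radii, and the \<open>t\<close>-sums would tend to \<open>0\<close> with the largest
  radius. In terms of dimensions, packing dimension is at most upper box dimension; the passage from
  \<open>t\<close> to a smaller \<open>u\<close> is the price for summing over the scales.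
\<close>
lemma frequently_large_packing_of_packing_measure:
  fixes A :: "'a::metric_space set"
  assumes t: "0 \<le> t" "u < t" and A: "packing_measure t A \<noteq> 0"
  shows "\<exists>\<^sub>F r in at_right 0. \<exists>Y. ball_packing r A Y \<and> r powr - u \<le> real (card Y)"
proof (rule ccontr)
  assume "\<not> ?thesis"
  then obtain r0 where r0: "0 < r0"
    "\<And>r Y. 0 < r \<Longrightarrow> r < r0 \<Longrightarrow> ball_packing r A Y \<Longrightarrow> real (card Y) < r powr - u"
    by (auto simp: frequently_def eventually_at_right_field not_le)
  define q :: real where "q = (1/2) powr (t - u)"
  define B where "B m = 2 powr t * (2 powr t * q ^ m / (1 - q))" for m :: nat
  have "(1/2) powr (t - u) < (1/2 :: real) powr 0"
    using t(2) by (intro powr_less_mono') auto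
  then have q: "0 < q" "q < 1"
    by (auto simp: q_def)
  have bound: "packing_premeasure t A \<le> ennreal (B m)" if m: "(1/2) ^ m < r0" for m
  proof -
    have "(\<Sum>\<^sub>\<infinity>(x, r)\<in>F. ennreal ((2 * r) powr t)) \<le> ennreal (B m)"
      if F: "is_packing ((1/2) ^ m) A F" for F
    proof -
      have "(\<Sum>(x, r)\<in>S. ennreal ((2 * r) powr t)) \<le> ennreal (B m)"
        if S: "finite S" "S \<subseteq> F" for S
      proof -
        have rad: "0 < snd p" "snd p \<le> (1/2) ^ m" "fst p \<in> A" if "p \<in> S" for p
          using F S(2) that unfolding is_packing_def case_prod_beta by blast+
        have dis: "disjnt (cball (fst p) (snd p)) (cball (fst p') (snd p'))"
          if "p \<in> S" "p' \<in> S" "p \<noteq> p'" for p p'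
          using F S(2) that unfolding is_packing_def pairwise_def by (auto simp: case_prod_beta)
        have "(\<Sum>p\<in>S. snd p powr t) \<le> 2 powr t * q ^ m / (1 - q)"
          unfolding q_def
        proof (rule sum_powr_le_of_counts[OF S(1) t])
          fix k assume "m \<le> k"
          then have "(1/2) ^ k \<le> (1/2 :: real) ^ m"
            by (intro power_decreasing) auto
          then have k: "(1/2) ^ k < r0"
            using m by linarith
          \<comment> \<open>The balls of \<open>P\<close>, shrunk to the common radius \<open>(1/2) ^ k\<close>, are still disjoint.\<close>
          define P where "P = {p \<in> S. (1/2) ^ k < snd p}"
          have inj: "inj_on fst P"
          proof (rule inj_onI, rule ccontr)
            fix p p' assume p: "p \<in> P" "p' \<in> P" "fst p = fst p'" "p \<noteq> p'"
            then have "fst p \<in> cball (fst p) (snd p) \<inter> cball (fst p') (snd p')"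
              using rad(1)[of p] rad(1)[of p'] by (simp add: P_def)
            then show False
              using dis[of p p'] p unfolding disjnt_def P_def by blast
          qed
          have "ball_packing ((1/2) ^ k) A (fst ` P)"
            unfolding ball_packing_def
          proof (intro conjI)
            show "pairwise (\<lambda>x y. disjnt (cball x ((1/2) ^ k)) (cball y ((1/2) ^ k))) (fst ` P)"
            proof (rule pairwiseI)
              fix x y assume "x \<in> fst ` P" "y \<in> fst ` P" "x \<noteq> y"
              then obtain p p' where p: "p \<in> P" "p' \<in> P" "p \<noteq> p'" "x = fst p" "y = fst p'"
                by auto
              have "cball x ((1/2) ^ k) \<subseteq> cball x (snd p)" "cball y ((1/2) ^ k) \<subseteq> cball y (snd p')"
                using p(1,2) by (auto simp: P_def)
              then show "disjnt (cball x ((1/2) ^ k)) (cball y ((1/2) ^ k))"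
                using dis[of p p'] p unfolding P_def by (auto simp: disjnt_def)
            qed
          qed (use S(1) rad(3) in \<open>auto simp: P_def\<close>)
          then have "real (card (fst ` P)) < ((1/2) ^ k) powr - u"
            using r0(2)[of "(1/2) ^ k"] k by simp
          then show "real (card {p \<in> S. (1/2) ^ k < snd p}) \<le> ((1/2) ^ k) powr - u"
            using card_image[OF inj] by (simp add: P_def)
        qed (use rad in auto)
        then have "2 powr t * (\<Sum>p\<in>S. snd p powr t) \<le> B m"
          unfolding B_def by (intro mult_left_mono) auto
        moreover have "(\<Sum>(x, r)\<in>S. ennreal ((2 * r) powr t)) = ennreal (2 powr t * (\<Sum>p\<in>S. snd p powr t))"
          by (simp add: case_prod_beta sum_ennreal sum_distrib_left powr_mult)
        ultimately show ?thesis
          by (simp add: ennreal_leI)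
      qed
      then show ?thesis
        by (intro infsum_le_finite_sums nonneg_summable_on_complete) auto
    qed
    then have "packing_premeasure_delta t ((1/2) ^ m) A \<le> ennreal (B m)"
      unfolding packing_premeasure_delta_def by (intro Sup_least) auto
    moreover have "packing_premeasure t A \<le> packing_premeasure_delta t ((1/2) ^ m) A"
      unfolding packing_premeasure_def by (intro INF_lower) simp
    ultimately show ?thesis
      by (rule order_trans[rotated])
  qed
  have "packing_premeasure t A = 0"
  proof -
    have "(\<lambda>m. q ^ m) \<longlonglongrightarrow> 0"
      using q by (intro LIMSEQ_power_zero) auto
    then have "B \<longlonglongrightarrow> 2 powr t * (2 powr t * 0 / (1 - q))"
      unfolding B_def by (intro tendsto_intros) (use q in auto)
    then have "(\<lambda>m. ennreal (B m)) \<longlonglongrightarrow> ennreal 0"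
      by (intro tendsto_ennrealI) simp
    moreover have "\<forall>\<^sub>F m in sequentially. (1/2) ^ m < r0"
      using order_tendstoD(2)[OF LIMSEQ_power_zero[of "1/2 :: real"]] r0(1) by simp
    then have "\<forall>\<^sub>F m in sequentially. packing_premeasure t A \<le> ennreal (B m)"
      by (rule eventually_mono) (rule bound)
    ultimately have "packing_premeasure t A \<le> ennreal 0"
      by (rule tendsto_lowerbound) simp
    then show ?thesis
      by simp
  qed
  moreover have "packing_measure t A \<le> (\<Sum>i::nat. packing_premeasure t A)"
    unfolding packing_measure_def by (intro Inf_lower) auto
  ultimately show False
    using A by simp
qed

text \<open>
  A null set of the packing measure lies in a countable union of sets of finite packing premeasure;
  testing the premeasure with balls of equal radius bounds the size of a packing of each of them.
\<close>
lemma packing_null_cover: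
  fixes G :: "'a::metric_space set"
  assumes "packing_measure t G = 0"
  shows "\<exists>V :: nat \<Rightarrow> 'a set. G \<subseteq> (\<Union>i. V i) \<and>
    (\<forall>i. \<forall>\<^sub>F r in at_right 0. \<forall>Y. ball_packing r (V i) Y \<longrightarrow> real (card Y) * (2 * r) powr t \<le> 1)"
proof -
  have "packing_measure t G < 1"
    using assms by simp
  then obtain V :: "nat \<Rightarrow> 'a set" where V: "G \<subseteq> (\<Union>i. V i)" "(\<Sum>i. packing_premeasure t (V i)) < 1"
    unfolding packing_measure_def Inf_less_iff by blast
  have "\<forall>\<^sub>F r in at_right 0. \<forall>Y. ball_packing r (V i) Y \<longrightarrow> real (card Y) * (2 * r) powr t \<le> 1" for i
  proof -
    have "packing_premeasure t (V i) \<le> (\<Sum>i. packing_premeasure t (V i))"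
      using sum_le_suminf[of "\<lambda>i. packing_premeasure t (V i)" "{i}"] by simp
    then have "packing_premeasure t (V i) < 1"
      using V(2) by (rule order_le_less_trans)
    then obtain \<delta> where \<delta>: "0 < \<delta>" "packing_premeasure_delta t \<delta> (V i) < 1"
      unfolding packing_premeasure_def INF_less_iff by auto
    have "real (card Y) * (2 * r) powr t \<le> 1" if r: "0 < r" "r < \<delta>" and Y: "ball_packing r (V i) Y" for r Y
    proof -
      have "is_packing \<delta> (V i) (Y \<times> {r})"
        using Y r unfolding is_packing_def ball_packing_def pairwise_def
        by (auto intro: countable_finite)
      then have "(\<Sum>\<^sub>\<infinity>(x, r)\<in>Y \<times> {r}. ennreal ((2 * r) powr t)) \<le> packing_premeasure_delta t \<delta> (V i)"
        unfolding packing_premeasure_delta_def by (intro Sup_upper) blast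
      also have "(\<Sum>\<^sub>\<infinity>(x, r)\<in>Y \<times> {r}. ennreal ((2 * r) powr t)) = (\<Sum>(x, r)\<in>Y \<times> {r}. ennreal ((2 * r) powr t))"
        using Y by (intro infsum_finite) (simp add: ball_packing_def)
      also have "\<dots> = ennreal (real (card Y) * (2 * r) powr t)"
        by (simp add: sum.cartesian_product[symmetric] ennreal_mult ennreal_of_nat_eq_real_of_nat)
      also note \<delta>(2)
      finally have "ennreal (real (card Y) * (2 * r) powr t) < ennreal 1"
        by simp
      then show ?thesis
        by (simp add: ennreal_less_iff)
    qed
    then show ?thesis
      unfolding eventually_at_right_field using \<delta>(1) by blast
  qed
  with V(1) show ?thesis
    by (intro exI[of _ V] conjI allI)
qed

section \<open>Second moments and sparse times\<close>

text \<open>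
  Chebyshev's inequality for the number of events that occur: its mean is \<open>card I * p\<close>, and near
  independence of the pairs keeps its variance small compared with the square of the mean.
\<close>
lemma (in prob_space) prob_miss_all_le:
  fixes E :: "'i \<Rightarrow> 'a set"
  assumes I: "finite I" "I \<noteq> {}" and E: "\<And>i. i \<in> I \<Longrightarrow> E i \<in> events"
    and p: "0 < p" "\<And>i. i \<in> I \<Longrightarrow> prob (E i) = p"
    and \<epsilon>: "0 \<le> \<epsilon>" "\<And>i j. i \<in> I \<Longrightarrow> j \<in> I \<Longrightarrow> i \<noteq> j \<Longrightarrow> prob (E i \<inter> E j) \<le> p\<^sup>2 * (1 + \<epsilon>)"
  shows "prob {x \<in> space M. \<forall>i\<in>I. x \<notin> E i} \<le> 1 / (real (card I) * p) + \<epsilon>"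
proof -
  define N where "N = real (card I)"
  have N: "0 < N"
    using I by (simp add: N_def card_gt_0_iff)
  define Z where "Z = {x \<in> space M. \<forall>i\<in>I. x \<notin> E i}"
  have "Z = space M - (\<Union>i\<in>I. E i)"
    by (auto simp: Z_def)
  then have Z: "Z \<in> events"
    using E I(1) by auto
  \<comment> \<open>The squared deviation of the counting variable from its mean, expanded so that its integral
    can be read off.\<close>
  define f where "f x = (\<Sum>i\<in>I. \<Sum>j\<in>I. indicat_real (E i \<inter> E j) x)
    - 2 * (N * p) * (\<Sum>i\<in>I. indicat_real (E i) x) + (N * p)\<^sup>2" for x
  have sq: "f x = ((\<Sum>i\<in>I. indicat_real (E i) x) - N * p)\<^sup>2" for x
    by (simp add: f_def power2_diff power2_eq_square[of "sum _ _"] sum_product indicator_inter_arith)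
  have ind: "has_bochner_integral M (indicat_real A) (prob A)" if "A \<in> events" for A
    using that by (intro has_bochner_integral_real_indicator) (auto simp: emeasure_eq_measure)
  have const: "has_bochner_integral M (\<lambda>_. c) c" for c :: real
    using prob_space by (simp add: has_bochner_integral_iff)
  have hf: "has_bochner_integral M f
      ((\<Sum>i\<in>I. \<Sum>j\<in>I. prob (E i \<inter> E j)) - 2 * (N * p) * (\<Sum>i\<in>I. prob (E i)) + (N * p)\<^sup>2)"
    unfolding f_def
    by (intro has_bochner_integral_add has_bochner_integral_diff has_bochner_integral_sum
        has_bochner_integral_mult_right const ind sets.Int E)
  have "(N * p)\<^sup>2 * prob Z = (\<integral>x. (N * p)\<^sup>2 * indicat_real Z x \<partial>M)"
    using Z by simp
  also have "\<dots> \<le> (\<integral>x. f x \<partial>M)"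
  proof (rule integral_mono)
    show "integrable M (\<lambda>x. (N * p)\<^sup>2 * indicat_real Z x)"
      using ind[OF Z] by (simp add: has_bochner_integral_iff)
    show "(N * p)\<^sup>2 * indicat_real Z x \<le> f x" for x
    proof (cases "x \<in> Z")
      case True
      then have "(\<Sum>i\<in>I. indicat_real (E i) x) = 0"
        by (intro sum.neutral) (auto simp: Z_def)
      then show ?thesis
        using True by (simp add: sq)
    qed (simp add: sq)
  qed (use hf in \<open>simp add: has_bochner_integral_iff\<close>)
  also have "(\<integral>x. f x \<partial>M) = (\<Sum>i\<in>I. \<Sum>j\<in>I. prob (E i \<inter> E j)) - 2 * (N * p) * (\<Sum>i\<in>I. prob (E i)) + (N * p)\<^sup>2"
    using hf by (simp add: has_bochner_integral_iff)
  also have "(\<Sum>i\<in>I. prob (E i)) = N * p"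
    using p(2) by (simp add: N_def)
  also have "(\<Sum>i\<in>I. \<Sum>j\<in>I. prob (E i \<inter> E j)) \<le> (\<Sum>i\<in>I. \<Sum>j\<in>I. p\<^sup>2 * (1 + \<epsilon>) + (if i = j then p else 0))"
    using \<epsilon> p by (intro sum_mono) auto
  also have "\<dots> = N\<^sup>2 * (p\<^sup>2 * (1 + \<epsilon>)) + N * p"
    using I(1) by (simp add: sum.distrib N_def power2_eq_square distrib_left)
  finally have "(N * p)\<^sup>2 * prob Z \<le> N * p + (N * p)\<^sup>2 * \<epsilon>"
    by (simp add: algebra_simps power2_eq_square)
  then have "prob Z \<le> (N * p + (N * p)\<^sup>2 * \<epsilon>) / (N * p)\<^sup>2"
    using N p(1) by (simp add: field_simps)
  also have "\<dots> = 1 / (N * p) + \<epsilon>"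
    using N p(1) by (simp add: field_simps power2_eq_square)
  finally show ?thesis
    by (simp add: Z_def N_def)
qed

text \<open>
  Two different numbers in one residue class modulo \<open>L\<close> differ by at least \<open>L\<close>, and one of the \<open>L\<close>
  classes contains at least the average share of \<open>D\<close>.
\<close>
lemma large_gap_subset:
  fixes D :: "nat set"
  assumes "finite D" "1 \<le> L"
  obtains I where "I \<subseteq> D" "card D \<le> L * card I" "\<And>n m. n \<in> I \<Longrightarrow> m \<in> I \<Longrightarrow> n < m \<Longrightarrow> L \<le> m - n"
proof -
  define R where "R j = {n \<in> D. n mod L = j}" for j
  have "\<exists>j. card D \<le> L * card (R j)"
  proof (rule ccontr)
    assume "\<not> ?thesis"
    then have less: "L * card (R j) < card D" for j
      by (simp add: not_le)
    have "D = (\<Union>j<L. R j)"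
      using assms(2) by (auto simp: R_def)
    then have "card D \<le> (\<Sum>j<L. card (R j))"
      using card_UN_le[of "{..<L}" R] by simp
    then have "L * card D \<le> (\<Sum>j<L. L * card (R j))"
      by (simp add: sum_distrib_left[symmetric])
    also have "\<dots> < (\<Sum>j<L. card D)"
      using less assms(2) by (intro sum_strict_mono) (auto simp: lessThan_empty_iff)
    finally show False
      by simp
  qed
  then obtain j where j: "card D \<le> L * card (R j)"
    by blast
  have "L \<le> m - n" if "n \<in> R j" "m \<in> R j" "n < m" for n m
  proof -
    have "L dvd m - n"
      using that by (metis (mono_tags, lifting) R_def mem_Collect_eq less_imp_le mod_eq_dvd_iff_nat)
    then show ?thesis
      using that(3) by (intro dvd_imp_le) auto
  qed
  then show ?thesis
    using that[of "R j"] j by (auto simp: R_def)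
qed

text \<open>
  The two error terms at scale \<open>r\<close>, with gap length about \<open>r powr - \<eta>\<close>. Any positive power of
  \<open>1 / r\<close> exceeds the logarithmic gap needed for mixing; \<open>\<eta>\<close> is half of the surplus \<open>t + a - s\<close>, so that
  losing the factor \<open>r powr - \<eta>\<close> in the number of times still leaves many expected visits.
\<close>
lemma miss_bound_tendsto_0:
  fixes a t s h c C \<rho> N :: real
  assumes "0 < a" "s < t + a" "0 < h" "0 < c" "0 < C" "0 < \<rho>" "\<rho> < 1"
  defines "\<eta> \<equiv> (t + a - s) / 2"
  shows "((\<lambda>r. (r powr - \<eta> + 1) / ((r powr - a - N) * (h * r powr - t * (r powr s / c)))
     + C * \<rho> powr (r powr - \<eta>) / (r powr s / c)) \<longlongrightarrow> 0) (at_right 0)"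
proof -
  have \<eta>: "0 < \<eta>" "- \<eta> - (- a - t + s) > 0"
    using assms(1,2) by (auto simp: \<eta>_def field_simps)
  have "((\<lambda>r. (r powr - \<eta> + 1) / ((r powr - a - N) * (h * r powr - t * (r powr s / c)))) \<longlongrightarrow> 0) (at_right 0)"
    using \<eta> assms by real_asymp
  moreover have "((\<lambda>r. C * \<rho> powr (r powr - \<eta>) / (r powr s / c)) \<longlongrightarrow> 0) (at_right 0)"
    using \<eta> assms by real_asymp
  ultimately show ?thesis
    using tendsto_add by fastforce
qed

section \<open>Orbits in exponentially mixing regular systems\<close>

context metric_mps
begin

lemma space_UNIV: "space M = UNIV"
  using sets_eq_imp_space_eq[OF sets_borel] by simp

lemma measurable_iterate: "(T ^^ n) \<in> measurable M M"
proof (induction n)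
  case (Suc n)
  then show ?case
    using measurable_comp[OF Suc measurable_T] by (simp add: comp_def)
qed (simp add: id_def)

lemma iterate_vimage_sets: "F \<in> sets M \<Longrightarrow> (T ^^ n) -` F \<in> sets M"
  using measurable_sets[OF measurable_iterate[of n], of F] by (simp add: space_UNIV)

lemma prob_iterate_vimage:
  assumes "F \<in> sets M"
  shows "prob ((T ^^ n) -` F) = prob F"
proof (induction n)
  case (Suc n)
  have "prob ((T ^^ Suc n) -` F) = prob (T -` ((T ^^ n) -` F))"
    by (simp add: funpow_Suc_right vimage_comp del: funpow.simps)
  also have "\<dots> = measure (distr M M T) ((T ^^ n) -` F)"
    using iterate_vimage_sets[OF assms] measurable_T by (simp add: measure_distr space_UNIV)
  also have "\<dots> = prob F"
    using Suc by (simp add: invariant)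
  finally show ?case .
qed simp

lemma closed_sets: "closed F \<Longrightarrow> F \<in> sets M"
  by (simp add: sets_borel)

lemma open_sets: "open F \<Longrightarrow> F \<in> sets M"
  by (simp add: sets_borel)

text \<open>
  The upper half of the mixing condition, in product form, which also makes sense if \<open>F\<close> is a null
  set.
\<close>
lemma exponentially_mixing_ball_bound:
  assumes "exponentially_mixing M T"
  obtains C \<rho> where "0 < C" "0 < \<rho>" "\<rho> < 1"
    "\<And>n c r F. 1 \<le> n \<Longrightarrow> 0 < r \<Longrightarrow> F \<in> sets M \<Longrightarrow>
       prob (cball c r \<inter> (T ^^ n) -` F) \<le> (prob (cball c r) + C * \<rho> ^ n) * prob F"
proof -
  obtain C \<rho> where C: "0 < C" "0 < \<rho>" "\<rho> < 1" and mix: "\<And>n c r F. 1 \<le> n \<Longrightarrow> F \<in> sets M \<Longrightarrow> 0 < r \<Longrightarrow> 0 < prob F \<Longrightarrow>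
      \<bar>cond_prob M (\<lambda>x. x \<in> cball c r) (\<lambda>x. (T ^^ n) x \<in> F) - prob (cball c r)\<bar> \<le> C * \<rho> ^ n"
    using assms unfolding exponentially_mixing_def by blast
  have "prob (cball c r \<inter> (T ^^ n) -` F) \<le> (prob (cball c r) + C * \<rho> ^ n) * prob F"
    if n: "1 \<le> n" "0 < r" and F: "F \<in> sets M" for n c r F
  proof (cases "prob F = 0")
    case True
    then have "prob ((T ^^ n) -` F) = 0"
      by (simp add: prob_iterate_vimage F)
    then show ?thesis
      using True finite_measure_mono[of "cball c r \<inter> (T ^^ n) -` F" "(T ^^ n) -` F"]
      by (simp add: iterate_vimage_sets F)
  next
    case False
    then have pos: "0 < prob F"
      by (simp add: zero_less_measure_iff)
    have "cond_prob M (\<lambda>x. x \<in> cball c r) (\<lambda>x. (T ^^ n) x \<in> F) = prob (cball c r \<inter> (T ^^ n) -` F) / prob F"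
      unfolding cond_prob_def prob_iterate_vimage[OF F, of n, symmetric]
      by (simp add: space_UNIV vimage_def Int_def)
    then have "prob (cball c r \<inter> (T ^^ n) -` F) / prob F \<le> prob (cball c r) + C * \<rho> ^ n"
      using mix[OF n(1) F n(2) pos, of c] by linarith
    then show ?thesis
      using pos by (simp add: divide_le_eq)
  qed
  then show ?thesis
    using that C by blast
qed

text \<open>
  Mixing is only assumed for balls, but it is additive over the disjoint balls that make up the
  target. The error \<open>card Y * C * \<rho> ^ L\<close> is harmless relative to the measure of the target, which is
  at least \<open>card Y * v\<close>.
\<close>
lemma prob_miss_packing_le:
  assumes C: "0 < C" "0 < \<rho>" "\<rho> < 1"
    and mix: "\<And>n c r F. 1 \<le> n \<Longrightarrow> 0 < r \<Longrightarrow> F \<in> sets M \<Longrightarrow>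
       prob (cball c r \<inter> (T ^^ n) -` F) \<le> (prob (cball c r) + C * \<rho> ^ n) * prob F"
    and Y: "ball_packing r A Y" "Y \<noteq> {}" and r: "0 < r"
    and v: "0 < v" "\<And>y. v \<le> prob (cball y r)"
    and I: "finite I" "I \<noteq> {}" and L: "1 \<le> L" "\<And>n m. n \<in> I \<Longrightarrow> m \<in> I \<Longrightarrow> n < m \<Longrightarrow> L \<le> m - n"
  shows "prob {x. \<forall>n\<in>I. (T ^^ n) x \<notin> (\<Union>y\<in>Y. cball y r)}
    \<le> 1 / (real (card I) * (real (card Y) * v)) + C * \<rho> ^ L / v"
proof -
  define U where "U = (\<Union>y\<in>Y. cball y r)"
  have finY: "finite Y" and disj: "disjoint_family_on (\<lambda>y. cball y r) Y"
    using Y(1) unfolding ball_packing_def disjoint_family_on_def pairwise_def disjnt_def by auto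
  have U: "U \<in> sets M"
    unfolding U_def using finY by (intro closed_sets closed_UN) auto
  have p: "prob U = (\<Sum>y\<in>Y. prob (cball y r))"
    unfolding U_def using finY disj by (intro finite_measure_finite_Union) (auto intro: closed_sets)
  have pv: "real (card Y) * v \<le> prob U"
    unfolding p using sum_bounded_below[of Y v "\<lambda>y. prob (cball y r)"] v(2) by simp
  have cardY: "0 < real (card Y)"
    using finY Y(2) by (simp add: card_gt_0_iff)
  then have pos: "0 < prob U"
    using pv v(1) by (smt (verit) mult_pos_pos)
  define \<epsilon> where "\<epsilon> = C * \<rho> ^ L / v"
  have corr: "prob (U \<inter> (T ^^ k) -` U) \<le> (prob U)\<^sup>2 * (1 + \<epsilon>)" if k: "L \<le> k" for k
  proof -
    have "U \<inter> (T ^^ k) -` U = (\<Union>y\<in>Y. cball y r \<inter> (T ^^ k) -` U)"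
      unfolding U_def by blast
    then have "prob (U \<inter> (T ^^ k) -` U) \<le> (\<Sum>y\<in>Y. prob (cball y r \<inter> (T ^^ k) -` U))"
      using finY by (simp only:) (intro finite_measure_subadditive_finite, auto intro: closed_sets iterate_vimage_sets U)
    also have "\<dots> \<le> (\<Sum>y\<in>Y. (prob (cball y r) + C * \<rho> ^ k) * prob U)"
      using k L(1) r U by (intro sum_mono mix) auto
    also have "\<dots> = (prob U + real (card Y) * (C * \<rho> ^ k)) * prob U"
      by (simp add: p sum_distrib_right[symmetric] sum.distrib)
    also have "\<dots> \<le> (prob U + prob U * \<epsilon>) * prob U"
    proof (intro mult_right_mono add_left_mono)
      have "\<rho> ^ k \<le> \<rho> ^ L"
        using C k by (intro power_decreasing) auto
      then have "real (card Y) * (C * \<rho> ^ k) \<le> real (card Y) * (C * \<rho> ^ L)"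
        using C by (intro mult_left_mono) auto
      also have "\<dots> = real (card Y) * v * \<epsilon>"
        using v(1) by (simp add: \<epsilon>_def)
      also have "\<dots> \<le> prob U * \<epsilon>"
        using pv C v(1) by (intro mult_right_mono) (auto simp: \<epsilon>_def)
      finally show "real (card Y) * (C * \<rho> ^ k) \<le> prob U * \<epsilon>" .
    qed simp
    finally show ?thesis
      by (simp add: power2_eq_square algebra_simps)
  qed
  have corr': "prob ((T ^^ n) -` U \<inter> (T ^^ m) -` U) \<le> (prob U)\<^sup>2 * (1 + \<epsilon>)"
    if nm: "n \<in> I" "m \<in> I" "n < m" for n m
  proof -
    have "(T ^^ m) x = (T ^^ (m - n)) ((T ^^ n) x)" for x
      using funpow_add[of "m - n" n T] nm(3) by simp
    then have "(T ^^ n) -` U \<inter> (T ^^ m) -` U = (T ^^ n) -` (U \<inter> (T ^^ (m - n)) -` U)"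
      by auto
    moreover have "prob ((T ^^ n) -` (U \<inter> (T ^^ (m - n)) -` U)) = prob (U \<inter> (T ^^ (m - n)) -` U)"
      by (intro prob_iterate_vimage sets.Int U iterate_vimage_sets)
    ultimately have "prob ((T ^^ n) -` U \<inter> (T ^^ m) -` U) = prob (U \<inter> (T ^^ (m - n)) -` U)"
      by simp
    then show ?thesis
      using corr[OF L(2)[OF nm]] by simp
  qed
  have "prob {x \<in> space M. \<forall>n\<in>I. x \<notin> (T ^^ n) -` U} \<le> 1 / (real (card I) * prob U) + \<epsilon>"
  proof (rule prob_miss_all_le[OF I _ pos])
    show "prob ((T ^^ i) -` U \<inter> (T ^^ j) -` U) \<le> (prob U)\<^sup>2 * (1 + \<epsilon>)"
      if "i \<in> I" "j \<in> I" "i \<noteq> j" for i j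
      using corr'[of i j] corr'[of j i] that by (cases "i < j") (auto simp: Int_commute)
    show "0 \<le> \<epsilon>"
      using C v(1) by (simp add: \<epsilon>_def)
  qed (simp_all add: U iterate_vimage_sets prob_iterate_vimage)
  also have "{x \<in> space M. \<forall>n\<in>I. x \<notin> (T ^^ n) -` U} = {x. \<forall>n\<in>I. (T ^^ n) x \<notin> U}"
    by (auto simp: space_UNIV)
  also have "1 / (real (card I) * prob U) \<le> 1 / (real (card I) * (real (card Y) * v))"
    using I cardY v(1) pv pos by (intro divide_left_mono mult_left_mono mult_pos_pos) (auto simp: card_gt_0_iff)
  finally show ?thesis
    by (simp add: U_def \<epsilon>_def)
qed

lemma ahlfors_regular_eventually:
  assumes "ahlfors_regular s M" "\<exists>x y :: 'a. x \<noteq> y"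
  obtains c where "1 \<le> c"
    "\<forall>\<^sub>F r in at_right 0. \<forall>x. r powr s / c \<le> prob (cball x r) \<and> prob (cball x r) \<le> c * r powr s"
proof -
  obtain c where c: "1 \<le> c" "\<And>x r. 0 < r \<Longrightarrow> r \<le> diameter (UNIV :: 'a set) \<Longrightarrow>
      inverse c * r powr s \<le> prob (cball x r) \<and> prob (cball x r) \<le> c * r powr s"
    using assms(1) unfolding ahlfors_regular_def by blast
  obtain x y :: 'a where "x \<noteq> y"
    using assms(2) by blast
  then have "0 < dist x y"
    by simp
  also have "dist x y \<le> diameter (UNIV :: 'a set)"
    by (intro diameter_bounded_bound compact_imp_bounded compact_space) auto
  finally have "0 < diameter (UNIV :: 'a set)" .
  then have "\<forall>\<^sub>F r in at_right 0. \<forall>x. r powr s / c \<le> prob (cball x r) \<and> prob (cball x r) \<le> c * r powr s"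
    unfolding eventually_at_right_field using c(2)
    by (intro exI[of _ "diameter (UNIV :: 'a set)"]) (auto simp: field_simps)
  then show ?thesis
    using that c(1) by blast
qed

text \<open>
  Disjoint balls have total measure at most \<open>1\<close>. This is what makes the index \<open>\<alpha>\<close> positive whenever
  there is a set of dimension larger than \<open>s - \<alpha>\<close>.
\<close>
lemma packing_exponent_le:
  fixes A :: "'a set"
  assumes reg: "ahlfors_regular s M" "\<exists>x y :: 'a. x \<noteq> y" and h: "0 < h"
    and freq: "\<exists>\<^sub>F r in at_right 0. \<exists>Y. ball_packing r A Y \<and> h * r powr - t \<le> real (card Y)"
  shows "t \<le> s"
proof (rule ccontr)
  assume "\<not> t \<le> s"
  obtain c where c: "1 \<le> c"
    "\<forall>\<^sub>F r in at_right 0. \<forall>x. r powr s / c \<le> prob (cball x r) \<and> prob (cball x r) \<le> c * r powr s"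
    using ahlfors_regular_eventually[OF reg] by blast
  have "0 < t - s" "0 < h / c"
    using \<open>\<not> t \<le> s\<close> h c(1) by auto
  then have "\<forall>\<^sub>F r in at_right 0. 1 < (h / c) * r powr - (t - s)"
    by real_asymp
  then have "\<exists>\<^sub>F r in at_right 0. (0 < r \<and> 1 < (h / c) * r powr - (t - s) \<and>
      (\<forall>x. r powr s / c \<le> prob (cball x r) \<and> prob (cball x r) \<le> c * r powr s)) \<and>
      (\<exists>Y. ball_packing r A Y \<and> h * r powr - t \<le> real (card Y))"
    using c(2) eventually_at_right_less[of "0 :: real"] freq
    by (intro frequently_eventually_conj) (auto intro: eventually_conj)
  then obtain r Y where r: "0 < r" "1 < (h / c) * r powr - (t - s)" "\<And>x. r powr s / c \<le> prob (cball x r)"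
    and Y: "ball_packing r A Y" "h * r powr - t \<le> real (card Y)"
    by (auto dest!: frequently_ex)
  have "(h / c) * r powr - (t - s) = (h * r powr - t) * (r powr s / c)"
    by (simp add: powr_add[symmetric])
  also have "\<dots> \<le> real (card Y) * (r powr s / c)"
    using Y(2) c(1) by (intro mult_right_mono) auto
  also have "\<dots> \<le> (\<Sum>y\<in>Y. prob (cball y r))"
    using sum_bounded_below[of Y "r powr s / c" "\<lambda>y. prob (cball y r)"] r(3) by simp
  also have "\<dots> = prob (\<Union>y\<in>Y. cball y r)"
    using Y(1) unfolding ball_packing_def
    by (intro finite_measure_finite_Union[symmetric])
       (auto simp: disjoint_family_on_def pairwise_def disjnt_def intro: closed_sets)
  also have "\<dots> \<le> 1"
    by (rule prob_le_1)
  finally show False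
    using r(2) by simp
qed

text \<open>
  Hitting at one good scale \<open>r\<close> is already enough, as \<open>dist ((T ^^ n) x) y \<le> r < ell n\<close>; so the
  probability of never hitting is at most the bound at each good scale, and hence \<open>0\<close>. Restricting to
  \<open>n \<ge> N\<close> costs at most \<open>N\<close> of the times.
\<close>
lemma AE_hits_neighbourhood:
  fixes A :: "'a set"
  assumes mixing: "exponentially_mixing M T"
    and reg: "ahlfors_regular s M" "\<exists>x y :: 'a. x \<noteq> y"
    and lim: "ell \<longlonglongrightarrow> 0"
    and h: "0 < h" and a: "0 < a" "s < t + a"
    and freq: "\<exists>\<^sub>F r in at_right 0. (\<exists>Y. ball_packing r A Y \<and> h * r powr - t \<le> real (card Y)) \<and>
       r powr - a \<le> real (card {n. 1 \<le> n \<and> r < ell n})"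
  shows "AE x in M. \<exists>n\<ge>N. 1 \<le> n \<and> (\<exists>y\<in>A. dist ((T ^^ n) x) y < ell n)"
proof -
  define Z where "Z = {x. \<forall>n\<ge>N. 1 \<le> n \<longrightarrow> (T ^^ n) x \<notin> (\<Union>y\<in>A. ball y (ell n))}"
  have Z_eq: "Z = (\<Inter>n\<in>{n. N \<le> n \<and> 1 \<le> n}. - ((T ^^ n) -` (\<Union>y\<in>A. ball y (ell n))))"
    by (auto simp: Z_def)
  have open_ev: "(T ^^ n) -` (\<Union>y\<in>A. ball y (ell n)) \<in> sets M" for n
    by (intro iterate_vimage_sets open_sets open_UN) auto
  have "Z \<in> sets M"
  proof -
    have "- ((T ^^ n) -` (\<Union>y\<in>A. ball y (ell n))) \<in> sets M" for n
      using sets.compl_sets[OF open_ev[of n]] by (simp add: space_UNIV Compl_eq_Diff_UNIV)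
    moreover have "UNIV \<in> sets M"
      using sets.top[of M] by (simp add: space_UNIV)
    ultimately show ?thesis
      unfolding Z_eq by (intro sets.countable_INT'') auto
  qed
  have "prob Z \<le> 0"
  proof (rule ccontr)
    assume pos: "\<not> prob Z \<le> 0"
    obtain C \<rho> where C: "0 < C" "0 < \<rho>" "\<rho> < 1" and mix: "\<And>n c r F. 1 \<le> n \<Longrightarrow> 0 < r \<Longrightarrow> F \<in> sets M \<Longrightarrow>
        prob (cball c r \<inter> (T ^^ n) -` F) \<le> (prob (cball c r) + C * \<rho> ^ n) * prob F"
      using exponentially_mixing_ball_bound[OF mixing] by blast
    obtain c where c: "1 \<le> c"
      "\<forall>\<^sub>F r in at_right 0. \<forall>x. r powr s / c \<le> prob (cball x r) \<and> prob (cball x r) \<le> c * r powr s"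
      using ahlfors_regular_eventually[OF reg] by blast
    define \<eta> where "\<eta> = (t + a - s) / 2"
    define \<beta> where "\<beta> r = (r powr - \<eta> + 1) / ((r powr - a - real N) * (h * r powr - t * (r powr s / c)))
      + C * \<rho> powr (r powr - \<eta>) / (r powr s / c)" for r
    have "(\<beta> \<longlongrightarrow> 0) (at_right 0)"
      unfolding \<beta>_def \<eta>_def using a h c(1) C by (intro miss_bound_tendsto_0) auto
    then have "\<forall>\<^sub>F r in at_right 0. \<beta> r < prob Z"
      using order_tendstoD(2) pos by fastforce
    moreover have "\<forall>\<^sub>F r in at_right 0. real N < r powr - a"
      using a(1) by real_asymp
    ultimately have "\<exists>\<^sub>F r in at_right 0. (0 < r \<and> \<beta> r < prob Z \<and> real N < r powr - a \<and>
        (\<forall>x. r powr s / c \<le> prob (cball x r) \<and> prob (cball x r) \<le> c * r powr s)) \<and>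
        (\<exists>Y. ball_packing r A Y \<and> h * r powr - t \<le> real (card Y)) \<and>
        r powr - a \<le> real (card {n. 1 \<le> n \<and> r < ell n})"
      using c(2) eventually_at_right_less[of "0 :: real"]
      by (intro frequently_eventually_conj[OF freq] eventually_conj)
    then obtain r Y where r: "0 < r" "\<beta> r < prob Z" "real N < r powr - a"
        "\<And>x. r powr s / c \<le> prob (cball x r)"
      and Y: "ball_packing r A Y" "h * r powr - t \<le> real (card Y)"
      and cnt: "r powr - a \<le> real (card {n. 1 \<le> n \<and> r < ell n})"
      by (auto dest!: frequently_ex)
    define v where "v = r powr s / c"
    have v: "0 < v"
      using r(1) c(1) by (simp add: v_def)
    define D where "D = {n. 1 \<le> n \<and> r < ell n \<and> N \<le> n}"
    have finD: "finite D"
      by (rule finite_subset[OF _ finite_large_terms[OF lim r(1)]]) (auto simp: D_def)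
    have "card {n. 1 \<le> n \<and> r < ell n} \<le> card (D \<union> {..<N})"
      using finD by (intro card_mono) (auto simp: D_def)
    also have "\<dots> \<le> card D + N"
      using card_Un_le[of D "{..<N}"] by simp
    finally have cardD: "r powr - a - real N \<le> real (card D)"
      using cnt by linarith
    \<comment> \<open>The gap between the times that are kept.\<close>
    define L where "L = nat \<lceil>r powr - \<eta>\<rceil>"
    have L: "1 \<le> L" "r powr - \<eta> \<le> real L" "real L \<le> r powr - \<eta> + 1"
    proof -
      have "0 < r powr - \<eta>"
        using r(1) by simp
      then show "1 \<le> L" "r powr - \<eta> \<le> real L" "real L \<le> r powr - \<eta> + 1"
        unfolding L_def by linarith+
    qed
    obtain I where I: "I \<subseteq> D" "card D \<le> L * card I"
      "\<And>n m. n \<in> I \<Longrightarrow> m \<in> I \<Longrightarrow> n < m \<Longrightarrow> L \<le> m - n"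
      using large_gap_subset[OF finD L(1)] by blast
    have finI: "finite I"
      using I(1) finD by (rule finite_subset)
    have "0 < card D"
      using cardD r(3) by linarith
    then have I_ne: "I \<noteq> {}"
      using I(2) by auto
    have hY: "0 < h * r powr - t"
      using h r(1) by simp
    then have "Y \<noteq> {}"
      using Y(2) by auto
    have cardI: "0 < real (card I)"
      using finI I_ne by (simp add: card_gt_0_iff)
    have "prob Z \<le> prob {x. \<forall>n\<in>I. (T ^^ n) x \<notin> (\<Union>y\<in>Y. cball y r)}"
    proof (rule finite_measure_mono)
      show "Z \<subseteq> {x. \<forall>n\<in>I. (T ^^ n) x \<notin> (\<Union>y\<in>Y. cball y r)}"
        using I(1) Y(1) unfolding Z_def D_def ball_packing_def by fastforce
      have "(T ^^ n) -` (\<Union>y\<in>Y. cball y r) \<in> sets M" for n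
        using Y(1) by (intro iterate_vimage_sets closed_sets closed_UN) (auto simp: ball_packing_def)
      then have "(\<Inter>n\<in>I. space M - (T ^^ n) -` (\<Union>y\<in>Y. cball y r)) \<in> sets M"
        using finI I_ne by (intro sets.finite_INT sets.compl_sets)
      also have "(\<Inter>n\<in>I. space M - (T ^^ n) -` (\<Union>y\<in>Y. cball y r)) = {x. \<forall>n\<in>I. (T ^^ n) x \<notin> (\<Union>y\<in>Y. cball y r)}"
        by (auto simp: space_UNIV)
      finally show "{x. \<forall>n\<in>I. (T ^^ n) x \<notin> (\<Union>y\<in>Y. cball y r)} \<in> sets M" .
    qed
    also have "\<dots> \<le> 1 / (real (card I) * (real (card Y) * v)) + C * \<rho> ^ L / v"
      using r(4) unfolding v_def[symmetric]
      by (intro prob_miss_packing_le[OF C mix Y(1) \<open>Y \<noteq> {}\<close> r(1) v _ finI I_ne L(1) I(3)]) auto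
    also have "\<dots> \<le> \<beta> r"
      unfolding \<beta>_def v_def[symmetric]
    proof (rule add_mono)
      have "(r powr - a - real N) * (h * r powr - t * v) \<le> real (card D) * (real (card Y) * v)"
        using cardD Y(2) hY v r(3) by (intro mult_mono mult_right_mono) auto
      also have "\<dots> \<le> (real L * real (card I)) * (real (card Y) * v)"
        using I(2) v by (intro mult_right_mono) (simp_all flip: of_nat_mult)
      also have "\<dots> \<le> ((r powr - \<eta> + 1) * real (card I)) * (real (card Y) * v)"
        using L(3) v by (intro mult_right_mono) auto
      finally have "(r powr - a - real N) * (h * r powr - t * v) \<le> (r powr - \<eta> + 1) * (real (card I) * (real (card Y) * v))"
        by (simp add: mult.assoc)
      moreover have "0 < (r powr - a - real N) * (h * r powr - t * v)"
        using hY v r(3) by simp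
      moreover have "0 < real (card I) * (real (card Y) * v)"
        using cardI hY Y(2) v by simp
      ultimately show "1 / (real (card I) * (real (card Y) * v))
          \<le> (r powr - \<eta> + 1) / ((r powr - a - real N) * (h * r powr - t * v))"
        by (simp add: divide_le_eq le_divide_eq field_simps)
      have "\<rho> ^ L = \<rho> powr real L"
        using C by (simp add: powr_realpow)
      also have "\<dots> \<le> \<rho> powr (r powr - \<eta>)"
        using C L(2) by (intro powr_mono') auto
      finally show "C * \<rho> ^ L / v \<le> C * \<rho> powr (r powr - \<eta>) / v"
        using C v by (intro divide_right_mono mult_left_mono) auto
    qed
    finally show False
      using r(2) by simp
  qed
  then have "Z \<in> null_sets M"
    using \<open>Z \<in> sets M\<close> measure_nonneg[of M Z] by (intro null_setsI) (auto simp: emeasure_eq_measure)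
  then show ?thesis
    by (rule AE_I') (force simp: Z_def dist_commute)
qed

lemma AE_hit_set_meets:
  fixes G :: "'a set"
  assumes I: "sigma_ideal small" and G: "analytic_set G" "\<not> small G"
    and hits: "\<And>A N. \<not> small A \<Longrightarrow> AE x in M. \<exists>n\<ge>N. 1 \<le> n \<and> (\<exists>y\<in>A. dist ((T ^^ n) x) y < ell n)"
  shows "AE x in M. hit_set T ell x \<inter> G \<noteq> {}"
proof -
  obtain \<A> where \<A>: "countable \<A>" "\<forall>A\<in>\<A>. \<not> small A"
    "\<forall>W :: nat \<Rightarrow> 'a set. (\<forall>n. open (W n)) \<longrightarrow> (\<forall>A\<in>\<A>. \<forall>n. A \<inter> W n \<noteq> {}) \<longrightarrow>
       G \<inter> (\<Inter>n. W n) \<noteq> {}"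
    using analytic_set_test_family[OF I G] by (elim exE conjE) (rule that)
  have "AE x in M. \<forall>A\<in>\<A>. \<forall>N. \<exists>n\<ge>N. 1 \<le> n \<and> (\<exists>y\<in>A. dist ((T ^^ n) x) y < ell n)"
  proof (subst AE_ball_countable[OF \<A>(1)], rule ballI, subst AE_all_countable, rule allI)
    fix A N assume "A \<in> \<A>"
    with \<A>(2) have "\<not> small A"
      by (rule bspec)
    then show "AE x in M. \<exists>n\<ge>N. 1 \<le> n \<and> (\<exists>y\<in>A. dist ((T ^^ n) x) y < ell n)"
      by (rule hits)
  qed
  then show ?thesis
  proof eventually_elim
    case (elim x)
    define W where "W N = (\<Union>n\<in>{n. N \<le> n \<and> 1 \<le> n}. ball ((T ^^ n) x) (ell n))" for N
    have "G \<inter> (\<Inter>N. W N) \<noteq> {}"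
    proof (intro \<A>(3)[rule_format])
      show "open (W N)" for N
        unfolding W_def by auto
      show "A \<inter> W N \<noteq> {}" if A: "A \<in> \<A>" for A N
      proof -
        obtain n y where "N \<le> n" "1 \<le> n" "y \<in> A" "dist ((T ^^ n) x) y < ell n"
          using elim[rule_format, OF A, of N] by blast
        then have "y \<in> A \<inter> W N"
          unfolding W_def by auto
        then show ?thesis
          by blast
      qed
    qed
    then obtain y where y: "y \<in> G" "\<And>N. y \<in> W N"
      by blast
    have "\<exists>n\<ge>N. n \<in> {n. n \<ge> 1 \<and> (T ^^ n) x \<in> cball y (ell n)}" for N
    proof -
      obtain n where n: "N \<le> n" "1 \<le> n" "y \<in> ball ((T ^^ n) x) (ell n)"
        using y(2)[of N] unfolding W_def by blast
      then have "(T ^^ n) x \<in> cball y (ell n)"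
        by (simp add: dist_commute)
      then show ?thesis
        using n(1,2) by blast
    qed
    then have "infinite {n. n \<ge> 1 \<and> (T ^^ n) x \<in> cball y (ell n)}"
      unfolding infinite_nat_iff_unbounded_le by blast
    then have "y \<in> hit_set T ell x"
      by (simp add: hit_set_def)
    then show ?case
      using y(1) by blast
  qed
qed

text \<open>
  A visit to within \<open>ell n\<close> of a point of \<open>V\<close> is a visit to one of the balls of radius \<open>3 * ell n\<close>
  around a maximal packing of radius \<open>ell n\<close>, which together have measure at most a constant times
  \<open>ell n powr (s - t)\<close>.
\<close>
lemma AE_hit_set_disjoint_of_packing_bound:
  assumes reg: "ahlfors_regular s M" "\<exists>x y :: 'a. x \<noteq> y"
    and ell: "\<And>n. n \<ge> 1 \<Longrightarrow> 0 < ell n" "ell \<longlonglongrightarrow> 0"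
    and sum: "summable (\<lambda>n. ell (Suc n) powr (s - t))"
    and V: "\<forall>\<^sub>F r in at_right 0. \<forall>Y. ball_packing r V Y \<longrightarrow> real (card Y) * (2 * r) powr t \<le> 1"
  shows "AE x in M. hit_set T ell x \<inter> V = {}"
proof -
  obtain c where c: "1 \<le> c"
    "\<forall>\<^sub>F r in at_right 0. \<forall>x. r powr s / c \<le> prob (cball x r) \<and> prob (cball x r) \<le> c * r powr s"
    using ahlfors_regular_eventually[OF reg] by blast
  obtain r1 where r1: "0 < r1" "\<And>r Y. 0 < r \<Longrightarrow> r < r1 \<Longrightarrow> ball_packing r V Y \<Longrightarrow> real (card Y) * (2 * r) powr t \<le> 1"
    using V unfolding eventually_at_right_field by auto
  obtain r2 where r2: "0 < r2" "\<And>r x. 0 < r \<Longrightarrow> r < r2 \<Longrightarrow> prob (cball x r) \<le> c * r powr s"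
    using c(2) unfolding eventually_at_right_field by auto
  define K where "K = 2 powr - t * (c * 3 powr s)"
  have "\<forall>\<^sub>F n in sequentially. ell n < r1 \<and> ell n < r2 / 3"
    using r1(1) r2(1) by (intro eventually_conj order_tendstoD(2)[OF ell(2)]) auto
  then obtain n0 where n0: "\<And>n. n0 \<le> n \<Longrightarrow> ell n < r1 \<and> ell n < r2 / 3"
    by (auto simp: eventually_sequentially)
  have ex: "\<exists>E. E \<in> sets M \<and> (max 1 n0 \<le> n \<longrightarrow>
      prob E \<le> K * ell n powr (s - t) \<and> {x. \<exists>y\<in>V. (T ^^ n) x \<in> cball y (ell n)} \<subseteq> E)" for n
  proof (cases "max 1 n0 \<le> n")
    case True
    then have r: "0 < ell n" "ell n < r1" "3 * ell n < r2"
      using ell(1)[of n] n0[of n] by auto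
    obtain Y where Y: "ball_packing (ell n) V Y" "V \<subseteq> (\<Union>y\<in>Y. cball y (2 * ell n))"
      using ball_packing_maximal[OF compact_space r(1)] by blast
    have finY: "finite Y"
      using Y(1) by (simp add: ball_packing_def)
    define F where "F = (\<Union>y\<in>Y. cball y (3 * ell n))"
    have F: "F \<in> sets M"
      unfolding F_def using finY by (intro closed_sets closed_UN) auto
    have "prob F \<le> (\<Sum>y\<in>Y. prob (cball y (3 * ell n)))"
      unfolding F_def using finY by (intro finite_measure_subadditive_finite) (auto intro: closed_sets)
    also have "\<dots> \<le> real (card Y) * (c * (3 * ell n) powr s)"
      using sum_bounded_above[of Y "\<lambda>y. prob (cball y (3 * ell n))"] r2(2)[of "3 * ell n"] r by simp
    also have "\<dots> \<le> (2 * ell n) powr - t * (c * (3 * ell n) powr s)"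
    proof (rule mult_right_mono)
      have "0 < (2 * ell n) powr t"
        using r(1) by simp
      then show "real (card Y) \<le> (2 * ell n) powr - t"
        using r1(2)[OF r(1,2) Y(1)] by (simp add: powr_minus_divide pos_le_divide_eq)
    qed (use c(1) in simp)
    also have "\<dots> = K * ell n powr (s - t)"
    proof -
      have "ell n powr (s - t) = ell n powr - t * ell n powr s"
        by (simp flip: powr_add)
      then show ?thesis
        using r(1) by (simp add: K_def powr_mult)
    qed
    finally have "prob ((T ^^ n) -` F) \<le> K * ell n powr (s - t)"
      by (simp add: prob_iterate_vimage F)
    moreover have "{x. \<exists>y\<in>V. (T ^^ n) x \<in> cball y (ell n)} \<subseteq> (T ^^ n) -` F"
    proof (rule subsetI)
      fix x assume "x \<in> {x. \<exists>y\<in>V. (T ^^ n) x \<in> cball y (ell n)}"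
      then obtain y where "y \<in> V" and x: "(T ^^ n) x \<in> cball y (ell n)"
        by blast
      then obtain z where z: "z \<in> Y" "y \<in> cball z (2 * ell n)"
        using Y(2) by blast
      have "dist z ((T ^^ n) x) \<le> 3 * ell n"
        using dist_triangle[of z "(T ^^ n) x" y] x z(2) by simp
      then show "x \<in> (T ^^ n) -` F"
        using z(1) by (auto simp: F_def)
    qed
    ultimately show ?thesis
      using iterate_vimage_sets[OF F] by blast
  qed (use sets.empty_sets in blast)
  obtain E where "\<forall>n. E n \<in> sets M \<and> (max 1 n0 \<le> n \<longrightarrow>
      prob (E n) \<le> K * ell n powr (s - t) \<and> {x. \<exists>y\<in>V. (T ^^ n) x \<in> cball y (ell n)} \<subseteq> E n)"
    by (rule exE[OF choice[OF allI[OF ex]]]) (rule that)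
  then have E: "\<And>n. E n \<in> sets M"
    "\<And>n. max 1 n0 \<le> n \<Longrightarrow> prob (E n) \<le> K * ell n powr (s - t)"
    "\<And>n. max 1 n0 \<le> n \<Longrightarrow> {x. \<exists>y\<in>V. (T ^^ n) x \<in> cball y (ell n)} \<subseteq> E n"
    by simp_all
  have "summable (\<lambda>n. ell n powr (s - t))"
    using sum by (subst (asm) summable_Suc_iff)
  then have "summable (\<lambda>n. K * ell n powr (s - t))"
    by (rule summable_mult)
  moreover have "\<forall>\<^sub>F n in sequentially. norm (prob (E n)) \<le> K * ell n powr (s - t)"
    using eventually_ge_at_top[of "max 1 n0"] by eventually_elim (simp add: E(2))
  ultimately have "summable (\<lambda>n. prob (E n))"
    by (rule summable_comparison_test_ev[rotated])
  then have "AE x in M. \<forall>\<^sub>F n in sequentially. x \<in> space M - E n"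
    using E(1) by (intro borel_cantelli_AE1) (auto simp: emeasure_eq_measure)
  then show ?thesis
  proof eventually_elim
    case (elim x)
    then obtain n1 where n1: "\<And>n. n1 \<le> n \<Longrightarrow> x \<notin> E n"
      by (auto simp: eventually_sequentially)
    have "y \<notin> hit_set T ell x" if "y \<in> V" for y
    proof -
      have "{n. n \<ge> 1 \<and> (T ^^ n) x \<in> cball y (ell n)} \<subseteq> {..<max n1 (max 1 n0)}"
      proof (rule subsetI, rule ccontr)
        fix n assume n: "n \<in> {n. n \<ge> 1 \<and> (T ^^ n) x \<in> cball y (ell n)}"
          "n \<notin> {..<max n1 (max 1 n0)}"
        then have "n1 \<le> n" "max 1 n0 \<le> n"
          by auto
        then show False
          using n1[of n] E(3)[of n] n(1) that by blast
      qed
      then have "finite {n. n \<ge> 1 \<and> (T ^^ n) x \<in> cball y (ell n)}"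
        by (rule finite_subset) simp
      then show ?thesis
        by (simp add: hit_set_def)
    qed
    then show ?case
      by blast
  qed
qed

end

section \<open>Scales prescribed by the level counts\<close>

text \<open>
  A scale \<open>r\<close> with many disjoint balls lies between \<open>b ^ k (Suc i)\<close> and \<open>b ^ k i\<close> for some \<open>i\<close>. The same
  centres work at the smaller radius \<open>b ^ k (Suc i)\<close>, and since \<open>k (Suc i) / k i\<close> is eventually below
  \<open>u / v\<close>, the number \<open>r powr - u\<close> of balls is at least the power with exponent \<open>- v\<close> of that radius.
\<close>
lemma frequently_large_packing_along_scales:
  fixes k :: "nat \<Rightarrow> nat"
  assumes b: "0 < b" "b < 1" and v: "0 < v" "v < u"
    and k: "mono k" "\<And>i. 1 \<le> k i" "filterlim k at_top sequentially"
      "(\<lambda>i. real (k (Suc i)) / real (k i)) \<longlonglongrightarrow> 1"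
    and P: "\<forall>\<^sub>F i in sequentially. P (k i)"
    and freq: "\<exists>\<^sub>F r in at_right 0. \<exists>Y. ball_packing r A Y \<and> r powr - u \<le> real (card Y)"
  shows "\<exists>\<^sub>F r in at_right 0. (\<exists>Y. ball_packing r A Y \<and> r powr - v \<le> real (card Y)) \<and> (\<exists>m. P m \<and> r = b ^ m)"
  unfolding frequently_def eventually_at_right_field
proof clarify
  fix r0 :: real assume r0: "0 < r0" and none: "\<forall>r>0. r < r0 \<longrightarrow>
    \<not> ((\<exists>Y. ball_packing r A Y \<and> r powr - v \<le> real (card Y)) \<and> (\<exists>m. P m \<and> r = b ^ m))"
  have "(\<lambda>m. b ^ m) \<longlonglongrightarrow> 0"
    using b by (intro LIMSEQ_power_zero) auto
  then have scale_0: "(\<lambda>i. b ^ k i) \<longlonglongrightarrow> 0"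
    using k(3) by (rule filterlim_compose)
  have "\<forall>\<^sub>F i in sequentially. real (k (Suc i)) / real (k i) < u / v \<and> b ^ k i < r0 \<and> P (k i)"
    using v r0 P by (intro eventually_conj order_tendstoD(2)[OF k(4)] order_tendstoD(2)[OF scale_0]) auto
  then obtain i0 where i0: "\<forall>i\<ge>i0. real (k (Suc i)) / real (k i) < u / v \<and> b ^ k i < r0 \<and> P (k i)"
    unfolding eventually_sequentially ..
  have "\<exists>\<^sub>F r in at_right 0. (0 < r \<and> r < b ^ k i0) \<and> (\<exists>Y. ball_packing r A Y \<and> r powr - u \<le> real (card Y))"
    using b(1) by (intro frequently_eventually_conj[OF freq] eventually_conj eventually_at_right_less)
      (auto simp: eventually_at_right_field intro!: exI[of _ "b ^ k i0"])
  then obtain r Y where r: "0 < r" "r < b ^ k i0" and Y: "ball_packing r A Y" "r powr - u \<le> real (card Y)"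
    by (auto dest!: frequently_ex)
  obtain j1 where "b ^ k j1 < r"
    using eventually_happens'[OF sequentially_bot order_tendstoD(2)[OF scale_0 r(1)]] ..
  then have ex: "\<exists>j. b ^ k j \<le> r"
    by (intro exI[of _ j1]) simp
  \<comment> \<open>The first prescribed scale not above \<open>r\<close>; it comes after \<open>i0\<close> because \<open>r < b ^ k i0\<close>.\<close>
  define j where "j = (LEAST j. b ^ k j \<le> r)"
  have j: "b ^ k j \<le> r"
    unfolding j_def using ex by (rule LeastI_ex)
  have "i0 < j"
  proof (rule ccontr)
    assume "\<not> i0 < j"
    then have "k j \<le> k i0"
      by (intro monoD[OF k(1)]) simp
    then have "b ^ k i0 \<le> b ^ k j"
      using b by (intro power_decreasing) auto
    then show False
      using j r(2) by linarith
  qed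
  then obtain i where i: "j = Suc i" "i0 \<le> i"
    by (cases j) auto
  have "r < b ^ k i"
    using not_less_Least[of i "\<lambda>j. b ^ k j \<le> r"] i(1) j_def by (simp add: not_le)
  have base: "(b ^ m) powr - w = b powr - (w * real m)" for m w
  proof -
    have "(b ^ m) powr - w = (b powr real m) powr - w"
      using b(1) by (simp only: powr_realpow)
    then show ?thesis
      by (simp only: powr_powr) (simp add: mult.commute)
  qed
  have "(b ^ k j) powr - v = b powr - (v * real (k j))"
    by (rule base)
  also have "\<dots> \<le> b powr - (u * real (k i))"
  proof (rule powr_mono')
    have "real (k j) / real (k i) < u / v"
      using i0[rule_format, OF i(2)] unfolding i(1) by (rule conjunct1)
    then have "real (k j) * v < u * real (k i)"
      using k(2)[of i] v(1) by (simp add: divide_less_eq less_divide_eq mult.commute)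
    then show "- (u * real (k i)) \<le> - (v * real (k j))"
      by (simp add: mult.commute)
  qed (use b in auto)
  also have "\<dots> = (b ^ k i) powr - u"
    by (rule base[symmetric])
  also have "\<dots> \<le> r powr - u"
    using \<open>r < b ^ k i\<close> r(1) v by (intro powr_mono2') auto
  also have "\<dots> \<le> real (card Y)"
    by (rule Y(2))
  finally have "(b ^ k j) powr - v \<le> real (card Y)" .
  moreover have "ball_packing (b ^ k j) A Y"
    using Y(1) j by (rule ball_packing_mono)
  moreover have "P (k j)" "b ^ k j < r0"
    using i0[rule_format, OF less_imp_le[OF \<open>i0 < j\<close>]] by simp_all
  moreover have "0 < b ^ k j"
    using b(1) by simp
  ultimately show False
    using none[rule_format, of "b ^ k j"] by blast
qed

lemma level_count_le_card:
  assumes b: "0 < b" "b < 1" and lim: "ell \<longlonglongrightarrow> 0"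
  shows "level_count b ell m \<le> card {n. 1 \<le> n \<and> b ^ m < ell n}"
  unfolding level_count_def
proof (rule card_mono)
  have "b ^ m < b powi (int m - 1)"
    using b by (simp add: power_int_diff divide_simps)
  then show "{n. n \<ge> 1 \<and> ell n \<in> {b powi (int m - 1) ..< b powi (int m - 2)}} \<subseteq> {n. 1 \<le> n \<and> b ^ m < ell n}"
    by auto
  show "finite {n. 1 \<le> n \<and> b ^ m < ell n}"
    using b by (intro finite_large_terms[OF lim]) simp
qed

lemma eventually_level_count_ge:
  fixes k :: "nat \<Rightarrow> nat"
  assumes b: "0 < b" "b < 1" and a: "a < \<alpha>" and k: "\<And>i. 1 \<le> k i"
    and lim: "(\<lambda>i. elog (inverse b) (level_count b ell (k i)) / ereal (real (k i))) \<longlonglongrightarrow> ereal \<alpha>"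
  shows "\<forall>\<^sub>F i in sequentially. (b ^ k i) powr - a \<le> real (level_count b ell (k i))"
proof -
  have "\<forall>\<^sub>F i in sequentially. ereal a < elog (inverse b) (level_count b ell (k i)) / ereal (real (k i))"
    using order_tendstoD(1)[OF lim] a by simp
  then show ?thesis
  proof eventually_elim
    case (elim i)
    let ?c = "level_count b ell (k i)"
    have ki: "0 < real (k i)"
      using k[of i] by simp
    have "?c \<noteq> 0"
    proof
      assume "?c = 0"
      then have "elog (inverse b) ?c / ereal (real (k i)) = - \<infinity>"
        using ki by (simp add: elog_def divide_ereal_def)
      then show False
        using elim by simp
    qed
    then have "a < log (inverse b) (real ?c) / real (k i)"
      using elim ki by (simp add: elog_def)
    then have "a * real (k i) < log (inverse b) (real ?c)"
      using ki by (simp add: field_simps)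
    then have "inverse b powr (a * real (k i)) < real ?c"
      using b \<open>?c \<noteq> 0\<close> by (subst (asm) less_log_iff) (auto simp: one_less_inverse_iff)
    also have "inverse b powr (a * real (k i)) = (b ^ k i) powr - a"
    proof -
      have "(b ^ k i) powr - a = (b powr real (k i)) powr - a"
        using b(1) by (simp only: powr_realpow)
      also have "\<dots> = b powr - (a * real (k i))"
        by (simp only: powr_powr) (simp add: mult.commute)
      also have "\<dots> = inverse b powr (a * real (k i))"
        using b(1) by (simp add: powr_minus inverse_powr)
      finally show ?thesis ..
    qed
    finally show ?case
      by simp
  qed
qed

section \<open>Hitting probabilities\<close>

lemma dim_exponent_gt:
  assumes "ereal c < Inf {ereal t | t. 0 \<le> t \<and> Q t}" "0 \<le> c"
  obtains t where "c < t" "\<not> Q t"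
proof -
  obtain t where t: "ereal c < ereal t" "ereal t < Inf {ereal t | t. 0 \<le> t \<and> Q t}"
    using ereal_dense2[OF assms(1)] by blast
  have "\<not> Q t"
  proof
    assume "Q t"
    then have "Inf {ereal t | t. 0 \<le> t \<and> Q t} \<le> ereal t"
      using t(1) assms(2) by (intro Inf_lower) auto
    then show False
      using t(2) by simp
  qed
  then show ?thesis
    using that t(1) by simp
qed

theorem theorem1p1:
  fixes M :: "'a::metric_space measure"
    and T :: "'a \<Rightarrow> 'a"
    and s \<alpha> :: real
    and ell :: "nat \<Rightarrow> real"
  assumes "metric_mps M T"
    and "\<exists>x y :: 'a. x \<noteq> y"
    and "exponentially_mixing M T"
    and "0 < s"
    and "ahlfors_regular s M"
    and "\<And>n. n \<ge> 1 \<Longrightarrow> 0 < ell n"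
    and "ell \<longlonglongrightarrow> 0"
    and "\<alpha> = upper_BT_index s ell"
    and "\<alpha> < s"
  shows "(\<forall>G :: 'a set. analytic_set G \<longrightarrow>
            (AE x in M.
               (packing_dim G < ereal (s - \<alpha>) \<longrightarrow> hit_set T ell x \<inter> G = {}) \<and>
               (hausdorff_dim G > ereal (s - \<alpha>) \<longrightarrow> hit_set T ell x \<inter> G \<noteq> {})))
       \<and> (\<forall>b :: real. 0 < b \<and> b < 1 / 3 \<and>
            (\<exists>k :: nat \<Rightarrow> nat. mono k \<and> (\<forall>i. k i \<ge> 1) \<and> filterlim k at_top sequentially \<and>
               (\<lambda>i. real (k (Suc i)) / real (k i)) \<longlonglongrightarrow> 1 \<and>
               (\<lambda>i. elog (inverse b) (level_count b ell (k i)) / ereal (real (k i)))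
                 \<longlonglongrightarrow> ereal \<alpha>) \<longrightarrow>
            (\<forall>G :: 'a set. analytic_set G \<longrightarrow> packing_dim G > ereal (s - \<alpha>) \<longrightarrow>
               (AE x in M. hit_set T ell x \<inter> G \<noteq> {})))"
proof -
  interpret metric_mps M T
    by fact
  note reg = \<open>ahlfors_regular s M\<close> \<open>\<exists>x y :: 'a. x \<noteq> y\<close>
  note mixing = \<open>exponentially_mixing M T\<close> and lim = \<open>ell \<longlonglongrightarrow> 0\<close>
  have pos: "0 < ell n" if "1 \<le> n" for n
    using assms(6) that .
  have codim: "0 < s - \<alpha>"
    using \<open>\<alpha> < s\<close> by simp
  have avoid: "AE x in M. hit_set T ell x \<inter> G = {}" if dim: "packing_dim G < ereal (s - \<alpha>)" for G :: "'a set"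
  proof (cases "G = {}")
    case False
    then have "Inf {ereal t | t. 0 \<le> t \<and> packing_measure t G = 0} < ereal (s - \<alpha>)"
      using dim by (simp add: packing_dim_def)
    then obtain t where t: "0 \<le> t" "packing_measure t G = 0" "t < s - \<alpha>"
      unfolding Inf_less_iff by auto
    let ?D = "{t. t \<le> s \<and> \<not> summable (\<lambda>n. ell (Suc n) powr t)}"
    have "s - t \<notin> ?D"
    proof
      assume "s - t \<in> ?D"
      then have "s - t \<le> Sup ?D"
        by (rule cSup_upper) (auto intro: bdd_aboveI[of _ s])
      then show False
        using t(3) \<open>\<alpha> = upper_BT_index s ell\<close> by (simp add: upper_BT_index_def)
    qed
    then have sum: "summable (\<lambda>n. ell (Suc n) powr (s - t))"
      using t(1) by simp
    obtain V :: "nat \<Rightarrow> 'a set" where V: "G \<subseteq> (\<Union>i. V i)"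
      "\<forall>i. \<forall>\<^sub>F r in at_right 0. \<forall>Y. ball_packing r (V i) Y \<longrightarrow> real (card Y) * (2 * r) powr t \<le> 1"
      using packing_null_cover[OF t(2)] by (elim exE conjE) (rule that)
    have "AE x in M. hit_set T ell x \<inter> V i = {}" for i
      using reg pos lim sum spec[OF V(2)] by (rule AE_hit_set_disjoint_of_packing_bound)
    then have "AE x in M. \<forall>i. hit_set T ell x \<inter> V i = {}"
      by (simp add: AE_all_countable)
    then show ?thesis
      by eventually_elim (use V(1) in blast)
  qed simp
  have hit: "AE x in M. hit_set T ell x \<inter> G \<noteq> {}"
    if G: "analytic_set G" and dim: "hausdorff_dim G > ereal (s - \<alpha>)" for G :: "'a set"
  proof -
    have inf: "ereal (s - \<alpha>) < Inf {ereal t | t. 0 \<le> t \<and> hausdorff_measure t G = 0}"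
      using dim by (simp add: hausdorff_dim_def split: if_splits)
    obtain t where t: "s - \<alpha> < t" "hausdorff_measure t G \<noteq> 0"
      by (rule dim_exponent_gt[OF inf less_imp_le[OF codim]])
    show ?thesis
    proof (rule AE_hit_set_meets[OF sigma_ideal_hausdorff_null G t(2)])
      fix A :: "'a set" and N :: nat
      assume A: "hausdorff_measure t A \<noteq> 0"
      have "0 < t"
        using t(1) codim by simp
      then obtain h where h: "0 < h"
        "\<forall>\<^sub>F r in at_right 0. \<exists>Y. ball_packing r A Y \<and> h * r powr - t \<le> real (card Y)"
        using eventually_large_packing_of_hausdorff[OF compact_space _ A] by blast
      have "t \<le> s"
        using reg h(1) eventually_frequently[OF trivial_limit_at_right_real h(2)]
        by (rule packing_exponent_le)
      \<comment> \<open>Between \<open>s - t\<close>, which is needed for hitting, and \<open>\<alpha>\<close>, which is available.\<close>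
      define a where "a = (s - t + \<alpha>) / 2"
      have a: "0 < a" "s < t + a" "a < upper_BT_index s ell"
        using \<open>t \<le> s\<close> t(1) \<open>\<alpha> = upper_BT_index s ell\<close> by (auto simp: a_def field_simps)
      have "\<exists>\<^sub>F r in at_right 0. r powr - a \<le> real (card {n. 1 \<le> n \<and> r < ell n})"
        using pos lim less_imp_le[OF a(1)] a(3) \<open>0 < s\<close> by (rule frequently_many_large_terms)
      then have "\<exists>\<^sub>F r in at_right 0. (\<exists>Y. ball_packing r A Y \<and> h * r powr - t \<le> real (card Y)) \<and>
          r powr - a \<le> real (card {n. 1 \<le> n \<and> r < ell n})"
        using h(2) by (rule frequently_eventually_conj)
      then show "AE x in M. \<exists>n\<ge>N. 1 \<le> n \<and> (\<exists>y\<in>A. dist ((T ^^ n) x) y < ell n)"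
        by (rule AE_hits_neighbourhood[OF mixing reg lim h(1) a(1,2)])
    qed
  qed
  have hit_packing: "AE x in M. hit_set T ell x \<inter> G \<noteq> {}"
    if G: "analytic_set G" and dim: "packing_dim G > ereal (s - \<alpha>)" and b: "0 < b" "b < 1"
      and k: "mono k" "\<And>i. 1 \<le> k i" "filterlim k at_top sequentially"
        "(\<lambda>i. real (k (Suc i)) / real (k i)) \<longlonglongrightarrow> 1"
        "(\<lambda>i. elog (inverse b) (level_count b ell (k i)) / ereal (real (k i))) \<longlonglongrightarrow> ereal \<alpha>"
    for G :: "'a set" and b :: real and k :: "nat \<Rightarrow> nat"
  proof -
    have inf: "ereal (s - \<alpha>) < Inf {ereal t | t. 0 \<le> t \<and> packing_measure t G = 0}"
      using dim by (simp add: packing_dim_def split: if_splits)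
    obtain t where t: "s - \<alpha> < t" "packing_measure t G \<noteq> 0"
      by (rule dim_exponent_gt[OF inf less_imp_le[OF codim]])
    \<comment> \<open>One loss in the exponent for passing from packing measure to packing numbers, a second one for
      moving to the scales \<open>b ^ k j\<close>.\<close>
    obtain u where u: "s - \<alpha> < u" "u < t"
      using dense[OF t(1)] by blast
    obtain v where v: "s - \<alpha> < v" "v < u"
      using dense[OF u(1)] by blast
    show ?thesis
    proof (rule AE_hit_set_meets[OF sigma_ideal_packing_null G t(2)])
      fix A :: "'a set" and N :: nat
      assume "packing_measure t A \<noteq> 0"
      then have freq: "\<exists>\<^sub>F r in at_right 0. \<exists>Y. ball_packing r A Y \<and> r powr - u \<le> real (card Y)"
        using t(1) u codim by (intro frequently_large_packing_of_packing_measure[of t u]) auto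
      have scales: "\<exists>\<^sub>F r in at_right 0. (\<exists>Y. ball_packing r A Y \<and> r powr - v \<le> real (card Y)) \<and> (\<exists>m. P m \<and> r = b ^ m)"
        if "\<forall>\<^sub>F i in sequentially. P (k i)" for P
        using v codim by (intro frequently_large_packing_along_scales[OF b _ v(2) k(1-4) that freq]) auto
      have "\<exists>\<^sub>F r in at_right 0. \<exists>Y. ball_packing r A Y \<and> 1 * r powr - v \<le> real (card Y)"
        using scales[of "\<lambda>_. True"] by (rule frequently_elim1) auto
      then have "v \<le> s"
        by (rule packing_exponent_le[OF reg zero_less_one])
      define a where "a = (s - v + \<alpha>) / 2"
      have a: "0 < a" "s < v + a" "a < \<alpha>"
        using \<open>v \<le> s\<close> v(1) by (auto simp: a_def field_simps)
      have "\<exists>\<^sub>F r in at_right 0. (\<exists>Y. ball_packing r A Y \<and> r powr - v \<le> real (card Y)) \<and>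
          (\<exists>m. (b ^ m) powr - a \<le> real (level_count b ell m) \<and> r = b ^ m)"
        using eventually_level_count_ge[OF b a(3) k(2,5)] by (rule scales)
      then have "\<exists>\<^sub>F r in at_right 0. (\<exists>Y. ball_packing r A Y \<and> 1 * r powr - v \<le> real (card Y)) \<and>
          r powr - a \<le> real (card {n. 1 \<le> n \<and> r < ell n})"
      proof (rule frequently_elim1, elim conjE exE)
        fix r Y m assume "ball_packing r A Y" "r powr - v \<le> real (card Y)" and m:
          "(b ^ m) powr - a \<le> real (level_count b ell m)" "r = b ^ m"
        moreover have "real (level_count b ell m) \<le> real (card {n. 1 \<le> n \<and> r < ell n})"
          using level_count_le_card[OF b lim, of m] by (simp add: m(2))
        ultimately show "(\<exists>Y. ball_packing r A Y \<and> 1 * r powr - v \<le> real (card Y)) \<and>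
            r powr - a \<le> real (card {n. 1 \<le> n \<and> r < ell n})"
          by auto
      qed
      then show "AE x in M. \<exists>n\<ge>N. 1 \<le> n \<and> (\<exists>y\<in>A. dist ((T ^^ n) x) y < ell n)"
        by (rule AE_hits_neighbourhood[OF mixing reg lim zero_less_one a(1,2)])
    qed
  qed
  show ?thesis
  proof (intro conjI allI impI)
    fix G :: "'a set" assume G: "analytic_set G"
    have "AE x in M. packing_dim G < ereal (s - \<alpha>) \<longrightarrow> hit_set T ell x \<inter> G = {}"
      by (rule AE_impI) (rule avoid)
    moreover have "AE x in M. hausdorff_dim G > ereal (s - \<alpha>) \<longrightarrow> hit_set T ell x \<inter> G \<noteq> {}"
      by (rule AE_impI) (rule hit[OF G])
    ultimately show "AE x in M. (packing_dim G < ereal (s - \<alpha>) \<longrightarrow> hit_set T ell x \<inter> G = {}) \<and>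
        (hausdorff_dim G > ereal (s - \<alpha>) \<longrightarrow> hit_set T ell x \<inter> G \<noteq> {})"
      by eventually_elim simp
  next
    fix b :: real and G :: "'a set"
    assume *: "0 < b \<and> b < 1 / 3 \<and> (\<exists>k :: nat \<Rightarrow> nat. mono k \<and> (\<forall>i. k i \<ge> 1) \<and> filterlim k at_top sequentially \<and>
        (\<lambda>i. real (k (Suc i)) / real (k i)) \<longlonglongrightarrow> 1 \<and>
        (\<lambda>i. elog (inverse b) (level_count b ell (k i)) / ereal (real (k i))) \<longlonglongrightarrow> ereal \<alpha>)"
    then obtain k :: "nat \<Rightarrow> nat" where k: "mono k" "\<And>i. 1 \<le> k i" "filterlim k at_top sequentially"
        "(\<lambda>i. real (k (Suc i)) / real (k i)) \<longlonglongrightarrow> 1"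
        "(\<lambda>i. elog (inverse b) (level_count b ell (k i)) / ereal (real (k i))) \<longlonglongrightarrow> ereal \<alpha>"
      by (elim conjE exE) (rule that, simp_all)
    have b: "0 < b" "b < 1"
      using * by simp_all
    assume "analytic_set G" "packing_dim G > ereal (s - \<alpha>)"
    then show "AE x in M. hit_set T ell x \<inter> G \<noteq> {}"
      using b k by (rule hit_packing)
  qed
qed

end
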